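(* Let $Q'$ be a polynomially bound maximisation problem whose optimal value is computable in deterministic polynomial time (i.e. $Q'\in\mathbf{Q'}$), with instances encoded as finite structures $\mathbf{A}$ over a vocabulary $\sigma$. Then the optimal value of $Q'$ can be represented as $$\mathrm{opt}_{Q'}(\mathbf{A})=\max_{\mathbf{S}}\bigl|\{\mathbf{w} : (\mathbf{A},\mathbf{S})\models \forall \mathbf{x}\,\eta(\mathbf{w},\mathbf{x},\mathbf{S})\}\bigr|$$ for every instance $\mathbf{A}$ of $Q'$, where $\mathbf{x}$ is a tuple of first-order variables, $\mathbf{w}$ ranges over tuples (of some fixed arity) of elements of the universe of $\mathbf{A}$, $\mathbf{S}$ is a sequence of second-order predicate symbols not in $\sigma$, and $\eta$ is a quantifier-free first-order formula that is a conjunction of Horn clauses.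
   Context: An optimisation problem is polynomially bound if there is a polynomial $p$ such that the optimal value of every instance $I$ satisfies $\mathrm{opt}(I)\le p(|I|)$. $\mathbf{P'}$ denotes the class of optimisation problems whose optimal value (solution) can be computed in deterministic polynomial time, and $\mathbf{Q'}\subseteq\mathbf{P'}$ is the subclass of polynomially bound ones. For such problems it is assumed that the objective value of a given solution and the feasibility of a given solution can be computed in deterministic polynomial time. A Horn clause here is a disjunction of literals containing at most one positive occurrence of any of the second-order predicates from $\mathbf{S}$. The sequence $\mathbf{S}$ encodes a solution to the instance $\mathbf{A}$.
   Formalization: The finite structures are taken to be ordered, with successor, first and last element available in η, and to have at least two elements; without an order (parity of the universe) or with a one-element universe (optimal value 2) the claim as stated fails. *)

theory Defs
  imports "HOL-Computational_Algebra.Polynomial"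
begin

section \<open>Deterministic polynomial time\<close>

text \<open>
  Single-tape deterministic Turing machines. The tape is infinite to the right only; a left move on
  cell 0 leaves the head where it is. States are the numbers below \<open>nstates\<close> and tape symbols the
  numbers below \<open>nsymbols\<close>. State 0 is initial. Symbol 0 is the blank; 1 and 2 are the input/output
  bits 0 and 1.
\<close>

datatype move = MoveLeft | Stay | MoveRight

record machine =
  nstates :: nat
  nsymbols :: nat
  halt_state :: nat
  trans :: "nat \<Rightarrow> nat \<Rightarrow> nat \<times> nat \<times> move"

definition wf_machine :: "machine \<Rightarrow> bool" where
  "wf_machine M \<longleftrightarrow>
     0 < nstates M \<and> 3 \<le> nsymbols M \<and> halt_state M < nstates M \<and>
     (\<forall>q < nstates M. \<forall>a < nsymbols M.
        case trans M q a of (q', a', d) \<Rightarrow> q' < nstates M \<and> a' < nsymbols M)"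

type_synonym config = "nat \<times> nat \<times> (nat \<Rightarrow> nat)" \<comment> \<open>state, head position, tape contents\<close>

fun move_head :: "move \<Rightarrow> nat \<Rightarrow> nat" where
  "move_head MoveLeft h = h - 1"
| "move_head Stay h = h"
| "move_head MoveRight h = h + 1"

definition step :: "machine \<Rightarrow> config \<Rightarrow> config" where
  "step M = (\<lambda>(q, h, tape).
     if q = halt_state M then (q, h, tape)
     else case trans M q (tape h) of (q', a, d) \<Rightarrow> (q', move_head d h, tape(h := a)))"

definition bit_symbol :: "bool \<Rightarrow> nat" where
  "bit_symbol b = (if b then 2 else 1)"

definition init_config :: "bool list \<Rightarrow> config" where
  "init_config x = (0, 0, \<lambda>i. if i < length x then bit_symbol (x ! i) else 0)"

text \<open>The output word occupies the tape from cell 0 up to the first blank.\<close>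

definition outputs_within :: "machine \<Rightarrow> bool list \<Rightarrow> nat \<Rightarrow> bool list \<Rightarrow> bool" where
  "outputs_within M x T y \<longleftrightarrow>
     (\<exists>t \<le> T. case (step M ^^ t) (init_config x) of (q, h, tape) \<Rightarrow>
        q = halt_state M \<and> (\<forall>i < length y. tape i = bit_symbol (y ! i)) \<and> tape (length y) = 0)"

text \<open>
  The map sending each \<open>i\<close> in \<open>D\<close>, presented to the machine as the word \<open>inp i\<close>, to the word
  \<open>out i\<close> is computable in time polynomial in the length of \<open>inp i\<close>. Nothing is required on words
  that do not present an element of \<open>D\<close>.
\<close>

definition polytime_computable ::
    "'i set \<Rightarrow> ('i \<Rightarrow> bool list) \<Rightarrow> ('i \<Rightarrow> bool list) \<Rightarrow> bool" where
  "polytime_computable D inp out \<longleftrightarrow>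
     (\<exists>M (p :: nat poly). wf_machine M \<and>
        (\<forall>i \<in> D. outputs_within M (inp i) (poly p (length (inp i))) (out i)))"

text \<open>Binary numerals, most significant bit first and without leading zeros; 0 is the empty word.\<close>

fun binary :: "nat \<Rightarrow> bool list" where
  "binary n = (if n = 0 then [] else binary (n div 2) @ [odd n])"

declare binary.simps [simp del]

text \<open>A self-delimiting pairing: the bits of the first word are doubled and followed by 01.\<close>

definition pair_word :: "bool list \<Rightarrow> bool list \<Rightarrow> bool list" where
  "pair_word x y = concat (map (\<lambda>b. [b, b]) x) @ [False, True] @ y"


section \<open>Finite ordered structures\<close>

text \<open>
  A vocabulary lists the arities of its relation symbols and has \<open>nconsts\<close> constant symbols;
  symbols are referred to by index.
\<close>

record vocabulary =
  rel_arities :: "nat list"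
  nconsts :: nat

definition tuples :: "nat \<Rightarrow> nat \<Rightarrow> nat list set" where
  "tuples n k = {xs. length xs = k \<and> set xs \<subseteq> {..<n}}"

text \<open>Interpretations of relation symbols of arities \<open>as\<close> over the universe \<open>{..<n}\<close>.\<close>

definition interpretations :: "nat \<Rightarrow> nat list \<Rightarrow> nat list set list set" where
  "interpretations n as =
     {Rs. length Rs = length as \<and> (\<forall>i < length as. Rs ! i \<subseteq> tuples n (as ! i))}"

record fin_structure =
  usize :: nat
  rels :: "nat list set list"
  const_vals :: "nat list"

text \<open>
  Every structure is ordered: its universe is \<open>{..<usize A}\<close>, and the successor relation and the
  first and last element of the natural order are available in formulas under a fixed
  interpretation (constructors \<open>Succ\<close>, \<open>First\<close>, \<open>Last\<close> below). Without them universal Horn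
  formulas do not capture polynomial time. Universes have at least two elements, as is usual in
  descriptive complexity: over a one-element universe there is only one tuple of each arity.
\<close>

definition structures :: "vocabulary \<Rightarrow> fin_structure set" where
  "structures \<sigma> =
     {A. 2 \<le> usize A \<and> rels A \<in> interpretations (usize A) (rel_arities \<sigma>) \<and>
         length (const_vals A) = nconsts \<sigma> \<and> set (const_vals A) \<subseteq> {..<usize A}}"

text \<open>
  The usual encoding of a structure with universe of size \<open>n\<close>: the word \<open>0\<^sup>n1\<close>, then for each
  relation its characteristic word along the lexicographic order of tuples. A constant is encoded
  as the unary relation holding of its value only.
\<close>

definition encode :: "vocabulary \<Rightarrow> fin_structure \<Rightarrow> bool list" where
  "encode \<sigma> A =
     (let n = usize A in
      replicate n False @ [True] @
      concat (map2 (\<lambda>R k. map (\<lambda>t. t \<in> R) (product_lists (replicate k [0..<n])))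
                (rels A) (rel_arities \<sigma>)) @
      concat (map (\<lambda>c. map (\<lambda>a. a = c) [0..<n]) (const_vals A)))"


section \<open>Maximisation problems\<close>

text \<open>Solutions are presented as binary words.\<close>

record max_problem =
  instances :: "fin_structure set"
  feasible :: "fin_structure \<Rightarrow> bool list \<Rightarrow> bool"
  objective :: "fin_structure \<Rightarrow> bool list \<Rightarrow> nat"

definition opt :: "max_problem \<Rightarrow> fin_structure \<Rightarrow> nat" where
  "opt Q A = Max {objective Q A s | s. feasible Q A s}"

text \<open>
  The second and third conditions say that \<open>opt\<close> is a genuine maximum on every instance. The last
  two are the standing assumption that feasibility and objective value of a given solution can be
  computed in polynomial time.
\<close>

definition maximisation_problem :: "vocabulary \<Rightarrow> max_problem \<Rightarrow> bool" where
  "maximisation_problem \<sigma> Q \<longleftrightarrow>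
     instances Q \<subseteq> structures \<sigma> \<and>
     (\<forall>A \<in> instances Q. \<exists>s. feasible Q A s) \<and>
     (\<forall>A \<in> instances Q. finite {objective Q A s | s. feasible Q A s}) \<and>
     polytime_computable {(A, s). A \<in> instances Q}
       (\<lambda>(A, s). pair_word (encode \<sigma> A) s) (\<lambda>(A, s). [feasible Q A s]) \<and>
     polytime_computable {(A, s). A \<in> instances Q \<and> feasible Q A s}
       (\<lambda>(A, s). pair_word (encode \<sigma> A) s) (\<lambda>(A, s). binary (objective Q A s))"

definition polynomially_bound :: "vocabulary \<Rightarrow> max_problem \<Rightarrow> bool" where
  "polynomially_bound \<sigma> Q \<longleftrightarrow>
     (\<exists>p :: nat poly. \<forall>A \<in> instances Q. opt Q A \<le> poly p (length (encode \<sigma> A)))"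

definition class_P' :: "vocabulary \<Rightarrow> max_problem set" where
  "class_P' \<sigma> =
     {Q. maximisation_problem \<sigma> Q \<and>
         polytime_computable (instances Q) (encode \<sigma>) (\<lambda>A. binary (opt Q A))}"

definition class_Q' :: "vocabulary \<Rightarrow> max_problem set" where
  "class_Q' \<sigma> = {Q \<in> class_P' \<sigma>. polynomially_bound \<sigma> Q}"


section \<open>Quantifier-free Horn formulas\<close>

datatype fo_term = Var nat | Const nat | First | Last

text \<open>
  \<open>Rel\<close> refers to the relation symbols of the vocabulary and \<open>SO\<close> to the second-order predicate
  symbols, so that the latter are never in the vocabulary.
\<close>

datatype atom =
    Eq fo_term fo_term
  | Succ fo_term fo_term
  | Rel nat "fo_term list"
  | SO nat "fo_term list"

datatype literal = Pos atom | Neg atom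

type_synonym clause = "literal list" \<comment> \<open>disjunction\<close>
type_synonym cnf = "clause list" \<comment> \<open>conjunction\<close>

fun wf_term :: "vocabulary \<Rightarrow> nat \<Rightarrow> fo_term \<Rightarrow> bool" where
  "wf_term \<sigma> v (Var i) \<longleftrightarrow> i < v"
| "wf_term \<sigma> v (Const c) \<longleftrightarrow> c < nconsts \<sigma>"
| "wf_term \<sigma> v First \<longleftrightarrow> True"
| "wf_term \<sigma> v Last \<longleftrightarrow> True"

text \<open>Here \<open>\<tau>\<close> lists the arities of the second-order predicates and \<open>v\<close> is the number of variables.\<close>

fun wf_atom :: "vocabulary \<Rightarrow> nat list \<Rightarrow> nat \<Rightarrow> atom \<Rightarrow> bool" where
  "wf_atom \<sigma> \<tau> v (Eq s t) \<longleftrightarrow> wf_term \<sigma> v s \<and> wf_term \<sigma> v t"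
| "wf_atom \<sigma> \<tau> v (Succ s t) \<longleftrightarrow> wf_term \<sigma> v s \<and> wf_term \<sigma> v t"
| "wf_atom \<sigma> \<tau> v (Rel i ts) \<longleftrightarrow>
     i < length (rel_arities \<sigma>) \<and> length ts = rel_arities \<sigma> ! i \<and> list_all (wf_term \<sigma> v) ts"
| "wf_atom \<sigma> \<tau> v (SO i ts) \<longleftrightarrow>
     i < length \<tau> \<and> length ts = \<tau> ! i \<and> list_all (wf_term \<sigma> v) ts"

fun wf_literal :: "vocabulary \<Rightarrow> nat list \<Rightarrow> nat \<Rightarrow> literal \<Rightarrow> bool" where
  "wf_literal \<sigma> \<tau> v (Pos a) \<longleftrightarrow> wf_atom \<sigma> \<tau> v a"
| "wf_literal \<sigma> \<tau> v (Neg a) \<longleftrightarrow> wf_atom \<sigma> \<tau> v a"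

definition wf_cnf :: "vocabulary \<Rightarrow> nat list \<Rightarrow> nat \<Rightarrow> cnf \<Rightarrow> bool" where
  "wf_cnf \<sigma> \<tau> v \<eta> \<longleftrightarrow> list_all (list_all (wf_literal \<sigma> \<tau> v)) \<eta>"

fun positive_SO :: "literal \<Rightarrow> bool" where
  "positive_SO (Pos (SO i ts)) \<longleftrightarrow> True"
| "positive_SO _ \<longleftrightarrow> False"

text \<open>Only occurrences of second-order predicates count; other atoms may occur positively freely.\<close>

definition horn_clause :: "clause \<Rightarrow> bool" where
  "horn_clause C \<longleftrightarrow> length (filter positive_SO C) \<le> 1"

definition horn_cnf :: "cnf \<Rightarrow> bool" where
  "horn_cnf \<eta> \<longleftrightarrow> list_all horn_clause \<eta>"

text \<open>Satisfaction in \<open>(A, S)\<close> under the assignment sending the \<open>i\<close>-th variable to \<open>e ! i\<close>.\<close>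

fun eval_term :: "fin_structure \<Rightarrow> nat list \<Rightarrow> fo_term \<Rightarrow> nat" where
  "eval_term A e (Var i) = e ! i"
| "eval_term A e (Const c) = const_vals A ! c"
| "eval_term A e First = 0"
| "eval_term A e Last = usize A - 1"

fun sat_atom :: "fin_structure \<Rightarrow> nat list set list \<Rightarrow> nat list \<Rightarrow> atom \<Rightarrow> bool" where
  "sat_atom A S e (Eq s t) \<longleftrightarrow> eval_term A e s = eval_term A e t"
| "sat_atom A S e (Succ s t) \<longleftrightarrow> eval_term A e t = Suc (eval_term A e s)"
| "sat_atom A S e (Rel i ts) \<longleftrightarrow> map (eval_term A e) ts \<in> rels A ! i"
| "sat_atom A S e (SO i ts) \<longleftrightarrow> map (eval_term A e) ts \<in> S ! i"

fun sat_literal :: "fin_structure \<Rightarrow> nat list set list \<Rightarrow> nat list \<Rightarrow> literal \<Rightarrow> bool" where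
  "sat_literal A S e (Pos a) \<longleftrightarrow> sat_atom A S e a"
| "sat_literal A S e (Neg a) \<longleftrightarrow> \<not> sat_atom A S e a"

definition sat_cnf :: "fin_structure \<Rightarrow> nat list set list \<Rightarrow> nat list \<Rightarrow> cnf \<Rightarrow> bool" where
  "sat_cnf A S e \<eta> \<longleftrightarrow> list_all (list_ex (sat_literal A S e)) \<eta>"

end

theory Submission
  imports Defs
begin

text \<open>
  Fix \<open>K\<close> so large that \<open>N = n ^ K\<close> exceeds the length of the encoded structure, the running time of
  the machine \<open>M\<close> computing \<open>opt\<close>, and \<open>opt\<close> itself, where \<open>n\<close> is the size of the universe. Numbers
  below \<open>N\<close> are represented by \<open>K\<close>-tuples, their base-\<open>n\<close> digits. A definite Horn program, which does
  not mention \<open>w\<close>, describes the run of \<open>M\<close> on the encoding, evaluates the binary word left on the tape,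
  and derives \<open>Bad v\<close> for every number \<open>v \<ge> opt\<close>. The only other clause is \<open>\<not> Bad w\<close>. If the predicates
  violate the program for some instance of \<open>x\<close>, no tuple \<open>w\<close> is counted; otherwise they contain
  everything that is derivable, so at most the tuples representing numbers below \<open>opt\<close> are counted.
  The intended interpretation attains this bound.
\<close>

section \<open>Numbers as digit tuples\<close>

text \<open>The predicates are chosen by the maximum, not by a least-model semantics, and definite
  Horn rules can only force facts into them. This is why \<open>Bad\<close> grows upwards from the
  optimum and the counted tuples lie in its complement. The second obstacle is that a rule body
  cannot test the absence of a second-order fact. What is needed negatively is derived positively:
  \<open>Less\<close> in either direction replaces inequality of cells, an explicit blank block
  replaces the absence of input, and a 0 bit comes from a first-order atom used with the opposite
  sign. A single \<open>K\<close> must serve all instances. It exists because the encoding is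
  polynomially long in \<open>n\<close> and, for \<open>n\<close> at least 2, powers of
  \<open>n\<close> also dominate the constants. Polynomial boundedness enters here: at most
  \<open>n ^ K\<close> tuples can be counted.\<close>

fun digits :: "nat \<Rightarrow> nat \<Rightarrow> nat \<Rightarrow> nat list" where
  "digits n 0 x = []"
| "digits n (Suc k) x = (x div n ^ k mod n) # digits n k x"

lemma length_digits [simp]: "length (digits n k x) = k"
  by (induction k) auto

lemma digits_add_mult: "0 < n \<Longrightarrow> digits n k (x + d * n ^ k) = digits n k x"
proof (induction k arbitrary: d)
  case (Suc k)
  have "(x + d * n ^ Suc k) div n ^ k = x div n ^ k + d * n"
    using Suc.prems div_mult_self1[of "n ^ k" x "d * n"] by (simp add: ac_simps)
  moreover have "digits n k (x + d * n ^ Suc k) = digits n k x"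
    using Suc.IH[of "d * n"] Suc.prems by (simp add: mult.assoc)
  ultimately show ?case by simp
qed simp

lemma digits_Suc_split:
  assumes "d < n" "r < n ^ k"
  shows "digits n (Suc k) (d * n ^ k + r) = d # digits n k r"
  using assms digits_add_mult[of n k r d] by (simp add: add.commute)

lemma digits_in_tuples: "0 < n \<Longrightarrow> digits n k x \<in> tuples n k"
  by (induction k) (auto simp: tuples_def)

lemma drop_digits: "a \<le> k \<Longrightarrow> drop (k - a) (digits n k x) = digits n a x"
  by (induction k) (auto simp: Suc_diff_le le_Suc_eq)

lemma inj_on_digits: "inj_on (digits n k) {..<n ^ k}"
proof -
  \<comment> \<open>Horner evaluation; \<open>rec_list\<close> keeps the tail \<open>ds\<close> at
    hand, whose length gives the weight of \<open>d\<close>. The result is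
    \<open>x mod n ^ k\<close>, hence \<open>x\<close> on the stated range.\<close>
  define f where "f = rec_list (0 :: nat) (\<lambda>d ds v. n ^ length ds * d + v)"
  have "f (digits n k x) = x mod n ^ k" for x
    by (induction k)
      (simp_all add: f_def mod_mult2_eq mult.commute[of n])
  then show ?thesis
    by (intro inj_on_inverseI[where g = f]) simp
qed

lemma digits_eq_iff:
  "x < n ^ k \<Longrightarrow> y < n ^ k \<Longrightarrow> digits n k x = digits n k y \<longleftrightarrow> x = y"
  using inj_on_digits[of n k] by (auto dest: inj_onD)

lemma tuples_conv_lists: "tuples n k = {xs. set xs \<subseteq> {..<n} \<and> length xs = k}"
  by (auto simp: tuples_def)

lemma finite_tuples: "finite (tuples n k)"
  unfolding tuples_conv_lists by (rule finite_lists_length_eq) simp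

lemma card_tuples: "card (tuples n k) = n ^ k"
  unfolding tuples_conv_lists by (simp add: card_lists_length_eq)

text \<open>Surjectivity by counting: an injective image of \<open>n ^ k\<close> numbers fills a set
  of \<open>n ^ k\<close> tuples.\<close>

lemma tuples_eq_digits: "0 < n \<Longrightarrow> tuples n k = digits n k ` {..<n ^ k}"
  by (rule card_subset_eq[symmetric])
    (auto simp: finite_tuples card_tuples card_image inj_on_digits digits_in_tuples)

lemma digits_0: "digits n k 0 = replicate k 0"
  by (induction k) auto

lemma digits_last: "2 \<le> n \<Longrightarrow> digits n k (n ^ k - 1) = replicate k (n - 1)"
proof (induction k)
  case (Suc k)
  have "n ^ Suc k - 1 = (n - 1) * n ^ k + (n ^ k - 1)"
    using Suc.prems by (cases n) (auto simp: algebra_simps)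
  then show ?case
    using Suc digits_Suc_split[of "n - 1" n "n ^ k - 1" k] by simp
qed simp

text \<open>The reason why \<open>NMax a\<close> can serve as a constant: its digits are first and
  last elements only, and formulas can name both.\<close>

lemma digits_last_le:
  assumes "2 \<le> n" "a \<le> k"
  shows "digits n k (n ^ a - 1) = replicate (k - a) 0 @ replicate a (n - 1)"
  using assms(2)
proof (induction k)
  case (Suc k)
  show ?case
  proof (cases "a = Suc k")
    case True
    then show ?thesis using digits_last[OF assms(1), of a] by simp
  next
    case False
    then have "a \<le> k" using Suc.prems by simp
    then have "n ^ a \<le> n ^ k" using assms by (intro power_increasing) auto
    moreover have "0 < n ^ a" using assms by simp
    ultimately have "n ^ a - 1 < n ^ k" by linarith
    then show ?thesis using Suc.IH \<open>a \<le> k\<close> by (simp add: Suc_diff_le)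
  qed
qed simp

lemma upt_mult: "[0..<n * m] = concat (map (\<lambda>d. map (\<lambda>r. d * m + r) [0..<m]) [0..<n])"
proof (induction n)
  case (Suc n)
  have "[0..<Suc n * m] = [0..<n * m] @ map (\<lambda>r. n * m + r) [0..<m]"
    using upt_add_eq_append[of 0 "n * m" m] map_add_upt[of "n * m" m]
    by (simp add: add.commute)
  then show ?case using Suc by simp
qed simp

text \<open>The lexicographic order in which \<open>encode\<close> lists tuples is the numerical
  order of their representations, so a tuple's position in its block is its number.\<close>

lemma product_lists_digits:
  "product_lists (replicate k [0..<n]) = map (digits n k) [0..<n ^ k]"
proof (induction k)
  case (Suc k)
  have "product_lists (replicate (Suc k) [0..<n]) =
      concat (map (\<lambda>d. map (\<lambda>r. d # digits n k r) [0..<n ^ k]) [0..<n])"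
    by (simp add: Suc o_def)
  also have "\<dots> = concat (map (\<lambda>d. map (\<lambda>r. digits n (Suc k) (d * n ^ k + r)) [0..<n ^ k]) [0..<n])"
    by (intro arg_cong[of _ _ concat] map_cong refl) (simp add: digits_Suc_split del: digits.simps)
  also have "\<dots> = map (digits n (Suc k)) [0..<n ^ Suc k]"
    by (simp add: upt_mult map_concat o_def del: digits.simps)
  finally show ?case .
qed simp

lemma append_in_tuples: "x \<in> tuples n k \<Longrightarrow> y \<in> tuples n m \<Longrightarrow> x @ y \<in> tuples n (k + m)"
  by (simp add: tuples_def)

lemma concat_digits_in_tuples:
  "0 < n \<Longrightarrow> concat (map (digits n k) vs) \<in> tuples n (length vs * k)"
proof (induction vs)
  case (Cons v vs)
  then show ?case using append_in_tuples[OF digits_in_tuples] by simp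
qed (simp add: tuples_def)

lemma tuples_mult:
  assumes "0 < n" "x \<in> tuples n (m * k)"
  shows "\<exists>vs. length vs = m \<and> set vs \<subseteq> {..<n ^ k} \<and> x = concat (map (digits n k) vs)"
  using assms(2)
proof (induction m arbitrary: x)
  case 0
  then show ?case by (simp add: tuples_def)
next
  case (Suc m)
  have take: "take k x \<in> tuples n k" and drop: "drop k x \<in> tuples n (m * k)"
    using Suc.prems by (auto simp: tuples_def dest: in_set_takeD in_set_dropD)
  obtain u where u: "take k x = digits n k u" "u < n ^ k"
    using take unfolding tuples_eq_digits[OF assms(1)] by blast
  obtain vs where vs: "length vs = m" "set vs \<subseteq> {..<n ^ k}" "drop k x = concat (map (digits n k) vs)"
    using Suc.IH[OF drop] by blast
  have "x = concat (map (digits n k) (u # vs))"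
    using append_take_drop_id[of k x] unfolding u vs by simp
  then show ?case
    using u(2) vs(1,2) by (intro exI[of _ "u # vs"]) auto
qed

text \<open>Adding 1 with carry, from the most significant digit. This shape uses only equality, the
  successor on elements and the two end elements, all expressible by atoms.\<close>

fun lex_next :: "nat \<Rightarrow> nat list \<Rightarrow> nat list \<Rightarrow> bool" where
  "lex_next n (x # xs) (y # ys) \<longleftrightarrow>
     y = Suc x \<and> (\<forall>z \<in> set xs. z = n - 1) \<and> (\<forall>z \<in> set ys. z = 0) \<or> x = y \<and> lex_next n xs ys"
| "lex_next n _ _ \<longleftrightarrow> False"

lemma digits_all_0: "0 < n \<Longrightarrow> x < n ^ k \<Longrightarrow> (\<forall>z \<in> set (digits n k x). z = 0) \<longleftrightarrow> x = 0"
  using digits_eq_iff[of x n k 0] replicate_length_same[of "digits n k x" 0] digits_0[of n k]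
  by (auto simp: set_replicate_conv_if split: if_splits)

lemma digits_all_last:
  assumes "2 \<le> n" "x < n ^ k"
  shows "(\<forall>z \<in> set (digits n k x). z = n - 1) \<longleftrightarrow> x = n ^ k - 1"
  using digits_eq_iff[of x n k "n ^ k - 1"] replicate_length_same[of "digits n k x" "n - 1"]
    digits_last[OF assms(1), of k] assms
  by (auto simp: set_replicate_conv_if split: if_splits)

lemma lex_next_digits:
  assumes "2 \<le> n" "x < n ^ k" "y < n ^ k"
  shows "lex_next n (digits n k x) (digits n k y) \<longleftrightarrow> y = Suc x"
  using assms(2,3)
proof (induction k arbitrary: x y)
  case (Suc k)
  define N where "N = n ^ k"
  define d r where "d = x div N" and "r = x mod N"
  define d' r' where "d' = y div N" and "r' = y mod N"
  have N: "0 < N" using assms by (simp add: N_def)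
  have eq: "x = d * N + r" "y = d' * N + r'" by (simp_all add: d_def r_def d'_def r'_def)
  have lt: "r < N" "r' < N" "d < n" "d' < n"
    using N Suc.prems by (simp_all add: r_def r'_def d_def d'_def N_def less_mult_imp_div_less)
  have "lex_next n (digits n (Suc k) x) (digits n (Suc k) y) \<longleftrightarrow>
      d' = Suc d \<and> r = N - 1 \<and> r' = 0 \<or> d = d' \<and> r' = Suc r"
    using lt eq digits_Suc_split[of d n r k] digits_Suc_split[of d' n r' k] Suc.IH[of r r']
      digits_all_0[of n r' k] digits_all_last[of n r k] assms(1)
    by (simp add: N_def del: digits.simps)
  also have "\<dots> \<longleftrightarrow> d' * N + r' = Suc (d * N + r)"
  proof
    assume *: "d' * N + r' = Suc (d * N + r)"
    show "d' = Suc d \<and> r = N - 1 \<and> r' = 0 \<or> d = d' \<and> r' = Suc r"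
    \<comment> \<open>\<open>Suc r = N\<close> is the case of a carry into the leading digit;
      otherwise quotient and remainder modulo \<open>N\<close> can be compared directly.\<close>
    proof (cases "Suc r = N")
      case True
      then have "d' * N + r' = Suc d * N + 0" using * by simp
      then show ?thesis using N lt True
        by (metis div_mult_self3 div_less add_diff_cancel_right' add_0_right diff_Suc_1
            add_left_cancel not_gr0)
    next
      case False
      then have "d' * N + r' = d * N + Suc r" "Suc r < N" using * lt by simp_all
      then show ?thesis using N lt
        by (metis div_mult_self3 div_less add_0_right add_left_cancel not_gr0)
    qed
  qed (use N in auto)
  finally show ?case using eq by simp
qed simp


section \<open>Horn clauses over numbers\<close>

text \<open>
  All predicates are binary on numbers. \<open>Val i v\<close>: the first \<open>i\<close> output bits have value \<open>v\<close>.
  \<open>Inp j x p\<close>: entry \<open>x\<close> of block \<open>j\<close> of the input is in cell \<open>p\<close>. \<open>Tape a t p\<close> and \<open>Head q t p\<close>: at time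
  \<open>t\<close>, cell \<open>p\<close> contains \<open>a\<close>, respectively the state is \<open>q\<close> and the head is on cell \<open>p\<close>. The second
  argument of \<open>Bad\<close> is a dummy.
\<close>

datatype pred = Next | Less | Double | Val | Bad | Inp nat | Tape nat | Head nat

fun pred_index :: "pred \<Rightarrow> nat" where
  "pred_index Next = 0"
| "pred_index Less = 1"
| "pred_index Double = 2"
| "pred_index Val = 3"
| "pred_index Bad = 4"
| "pred_index (Inp j) = 5 + 3 * j"
| "pred_index (Tape a) = 6 + 3 * a"
| "pred_index (Head q) = 7 + 3 * q"

text \<open>Above the five fixed indices, the residue modulo 3 separates the three families.\<close>

lemma pred_index_inject: "pred_index P = pred_index P' \<longleftrightarrow> P = P'"
  by (cases P; cases P') (auto, presburger+)

text \<open>\<open>NMax a\<close> denotes \<open>n ^ a - 1\<close>, the last number whose digits encode an \<open>a\<close>-tuple; \<open>NMax 0\<close> is 0.\<close>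

datatype num_term = NVar nat | NMax nat

type_synonym num_atom = "pred \<times> num_term \<times> num_term"

text \<open>First-order literals, which may have either sign, are kept apart from the predicate
  atoms. With at most one head, the translation is Horn by construction.\<close>

datatype num_clause = NClause "literal list" "num_atom list" "num_atom option"

fun term_tuple :: "nat \<Rightarrow> num_term \<Rightarrow> fo_term list" where
  "term_tuple K (NVar i) = map (\<lambda>l. Var (i * K + l)) [0..<K]"
| "term_tuple K (NMax a) = replicate (K - a) First @ replicate a Last"

fun atom_of :: "nat \<Rightarrow> num_atom \<Rightarrow> atom" where
  "atom_of K (P, s, t) = SO (pred_index P) (term_tuple K s @ term_tuple K t)"

fun clause_of :: "nat \<Rightarrow> num_clause \<Rightarrow> clause" where
  "clause_of K (NClause fo body head) =
     fo @ map (\<lambda>a. Neg (atom_of K a)) body @ (case head of None \<Rightarrow> [] | Some a \<Rightarrow> [Pos (atom_of K a)])"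

fun num_val :: "nat \<Rightarrow> nat list \<Rightarrow> num_term \<Rightarrow> nat" where
  "num_val n vs (NVar i) = vs ! i"
| "num_val n vs (NMax a) = n ^ a - 1"

type_synonym num_interp = "pred \<Rightarrow> nat \<Rightarrow> nat \<Rightarrow> bool"

fun num_atom_holds :: "nat \<Rightarrow> num_interp \<Rightarrow> nat list \<Rightarrow> num_atom \<Rightarrow> bool" where
  "num_atom_holds n I vs (P, s, t) \<longleftrightarrow> I P (num_val n vs s) (num_val n vs t)"

definition digit_env :: "fin_structure \<Rightarrow> nat \<Rightarrow> nat list \<Rightarrow> nat list" where
  "digit_env A K vs = concat (map (digits (usize A) K) vs)"

text \<open>The empty list stands in for the second-order predicates, on which well-formed
  first-order literals do not depend.\<close>

fun num_clause_holds :: "fin_structure \<Rightarrow> nat \<Rightarrow> num_interp \<Rightarrow> nat list \<Rightarrow> num_clause \<Rightarrow> bool" where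
  "num_clause_holds A K I vs (NClause fo body head) \<longleftrightarrow>
     (\<exists>l \<in> set fo. sat_literal A [] (digit_env A K vs) l) \<or>
     (\<exists>a \<in> set body. \<not> num_atom_holds (usize A) I vs a) \<or>
     (\<exists>a \<in> set_option head. num_atom_holds (usize A) I vs a)"

definition interp_of :: "nat \<Rightarrow> nat \<Rightarrow> nat list set list \<Rightarrow> num_interp" where
  "interp_of n K S P u v \<longleftrightarrow> digits n K u @ digits n K v \<in> S ! pred_index P"

definition relations_of :: "nat \<Rightarrow> nat \<Rightarrow> nat \<Rightarrow> num_interp \<Rightarrow> nat list set list" where
  "relations_of n K L I =
     map (\<lambda>i. {digits n K u @ digits n K v | P u v.
                 pred_index P = i \<and> u < n ^ K \<and> v < n ^ K \<and> I P u v}) [0..<L]"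

fun wf_num_term :: "nat \<Rightarrow> nat \<Rightarrow> num_term \<Rightarrow> bool" where
  "wf_num_term m K (NVar i) \<longleftrightarrow> i < m"
| "wf_num_term m K (NMax a) \<longleftrightarrow> a \<le> K"

fun wf_num_atom :: "nat \<Rightarrow> nat \<Rightarrow> nat \<Rightarrow> num_atom \<Rightarrow> bool" where
  "wf_num_atom L m K (P, s, t) \<longleftrightarrow> pred_index P < L \<and> wf_num_term m K s \<and> wf_num_term m K t"

text \<open>Well-formedness over the empty list of arities excludes second-order predicates.\<close>

fun wf_num_clause :: "vocabulary \<Rightarrow> nat \<Rightarrow> nat \<Rightarrow> nat \<Rightarrow> num_clause \<Rightarrow> bool" where
  "wf_num_clause \<sigma> L m K (NClause fo body head) \<longleftrightarrow>
     list_all (wf_literal \<sigma> [] (m * K)) fo \<and>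
     list_all (wf_num_atom L m K) body \<and> (\<forall>a \<in> set_option head. wf_num_atom L m K a)"

lemma relations_of_interpretations:
  assumes "0 < n"
  shows "relations_of n K L I \<in> interpretations n (replicate L (2 * K))"
  using append_in_tuples[OF digits_in_tuples[OF assms] digits_in_tuples[OF assms], of K _ K]
  by (auto simp: relations_of_def interpretations_def mult_2)

lemma interp_of_relations_of:
  assumes "pred_index P < L" "u < n ^ K" "v < n ^ K"
  shows "interp_of n K (relations_of n K L I) P u v \<longleftrightarrow> I P u v"
  using assms by (auto simp: interp_of_def relations_of_def pred_index_inject digits_eq_iff)

lemma nth_concat_digits:
  "i < length vs \<Longrightarrow> l < K \<Longrightarrow> concat (map (digits n K) vs) ! (i * K + l) = digits n K (vs ! i) ! l"
proof (induction vs arbitrary: i)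
  case (Cons v vs)
  then show ?case by (cases i) (simp_all add: nth_append)
qed simp

lemma map_eval_term_tuple:
  assumes "2 \<le> usize A" "wf_num_term (length vs) K s"
  shows "map (eval_term A (digit_env A K vs)) (term_tuple K s) =
    digits (usize A) K (num_val (usize A) vs s)"
proof (cases s)
  case (NVar i)
  then have "map (eval_term A (digit_env A K vs)) (term_tuple K s) =
      map (\<lambda>l. digits (usize A) K (vs ! i) ! l) [0..<K]"
    using assms(2) by (auto simp: digit_env_def nth_concat_digits)
  also have "\<dots> = digits (usize A) K (vs ! i)"
    using map_nth[of "digits (usize A) K (vs ! i)"] by simp
  finally show ?thesis using NVar by simp
next
  case (NMax a)
  then show ?thesis using assms digits_last_le[of "usize A" a K] by simp
qed

lemma sat_atom_of:
  assumes "2 \<le> usize A" "wf_num_atom L (length vs) K a"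
  shows "sat_atom A S (digit_env A K vs) (atom_of K a) \<longleftrightarrow>
    num_atom_holds (usize A) (interp_of (usize A) K S) vs a"
  using assms by (cases a) (simp add: map_eval_term_tuple interp_of_def)

lemma sat_literal_first_order:
  "wf_literal \<sigma> [] m l \<Longrightarrow> sat_literal A S e l \<longleftrightarrow> sat_literal A [] e l"
  by (cases "(\<sigma>, [] :: nat list, m, l)" rule: wf_literal.cases; rename_tac a; case_tac a) auto

lemma sat_clause_of:
  assumes "2 \<le> usize A" "wf_num_clause \<sigma> L (length vs) K c"
  shows "list_ex (sat_literal A S (digit_env A K vs)) (clause_of K c) \<longleftrightarrow>
    num_clause_holds A K (interp_of (usize A) K S) vs c"
proof (cases c)
  case (NClause fo body head)
  have fo: "(\<exists>l \<in> set fo. sat_literal A S (digit_env A K vs) l) \<longleftrightarrow>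
      (\<exists>l \<in> set fo. sat_literal A [] (digit_env A K vs) l)"
    using assms(2) NClause by (intro bex_cong refl sat_literal_first_order) (auto simp: list_all_iff)
  have body: "(\<exists>a \<in> set body. \<not> sat_atom A S (digit_env A K vs) (atom_of K a)) \<longleftrightarrow>
      (\<exists>a \<in> set body. \<not> num_atom_holds (usize A) (interp_of (usize A) K S) vs a)"
    using assms(2) NClause
    by (intro bex_cong refl arg_cong[of _ _ Not] sat_atom_of[OF assms(1), of L]) (auto simp: list_all_iff)
  have head: "(\<exists>a \<in> set_option head. sat_atom A S (digit_env A K vs) (atom_of K a)) \<longleftrightarrow>
      (\<exists>a \<in> set_option head. num_atom_holds (usize A) (interp_of (usize A) K S) vs a)"
    using assms(2) NClause by (intro bex_cong refl sat_atom_of[OF assms(1), of L]) auto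
  show ?thesis
    unfolding NClause clause_of.simps num_clause_holds.simps fo[symmetric] body[symmetric] head[symmetric]
    by (cases head) (simp_all add: list_ex_iff bex_Un disj_ac del: atom_of.simps)
qed

text \<open>The bridge from formulas to numbers: every tuple of length \<open>m * K\<close> is the
  concatenation of \<open>m\<close> digit tuples, so quantifying over \<open>x\<close> is
  quantifying over \<open>m\<close> numbers below \<open>n ^ K\<close>, with \<open>w\<close> as
  number 0.\<close>

lemma sat_num_clauses:
  assumes A: "2 \<le> usize A" and wf: "\<forall>c \<in> set cs. wf_num_clause \<sigma> L (Suc m) K c"
  shows "(\<forall>x \<in> tuples (usize A) (m * K).
      sat_cnf A S (digits (usize A) K w @ x) (map (clause_of K) cs)) \<longleftrightarrow>
    (\<forall>vs. length vs = m \<longrightarrow> set vs \<subseteq> {..<usize A ^ K} \<longrightarrow>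
      (\<forall>c \<in> set cs. num_clause_holds A K (interp_of (usize A) K S) (w # vs) c))"
    (is "?L \<longleftrightarrow> ?R")
proof -
  have *: "sat_cnf A S (digits (usize A) K w @ concat (map (digits (usize A) K) vs)) (map (clause_of K) cs) \<longleftrightarrow>
      (\<forall>c \<in> set cs. num_clause_holds A K (interp_of (usize A) K S) (w # vs) c)"
    if "length vs = m" for vs
    using that wf sat_clause_of[OF A, of \<sigma> L "w # vs" K _ S]
    by (auto simp: sat_cnf_def list_all_iff digit_env_def)
  show ?thesis
  proof
    assume ?L
    then show ?R
      using * concat_digits_in_tuples[of "usize A" K] A
      by (metis not_gr0 not_numeral_le_zero)
  next
    assume ?R
    show ?L
    proof
      fix x assume "x \<in> tuples (usize A) (m * K)"
      then obtain vs where "length vs = m" "set vs \<subseteq> {..<usize A ^ K}"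
          "x = concat (map (digits (usize A) K) vs)"
        using tuples_mult[of "usize A" x m K] A by auto
      then show "sat_cnf A S (digits (usize A) K w @ x) (map (clause_of K) cs)"
        using * \<open>?R\<close> by simp
    qed
  qed
qed

lemma num_val_less:
  assumes "2 \<le> n" "wf_num_term (length vs) K s" "set vs \<subseteq> {..<n ^ K}"
  shows "num_val n vs s < n ^ K"
proof (cases s)
  case (NVar i)
  then show ?thesis using assms(2,3) nth_mem[of i vs] by (auto simp del: nth_mem)
next
  case (NMax a)
  then have "n ^ a \<le> n ^ K" using assms by (intro power_increasing) auto
  moreover have "0 < n ^ a" using assms by simp
  ultimately have "n ^ a - 1 < n ^ K" by linarith
  then show ?thesis using NMax by simp
qed

text \<open>Truncating \<open>I\<close> to numbers below \<open>n ^ K\<close> changes nothing,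
  because every term of a well-formed clause takes a value in that range.\<close>

lemma num_clause_holds_relations_of:
  assumes A: "2 \<le> usize A" and wf: "wf_num_clause \<sigma> L (length vs) K c"
    and vs: "set vs \<subseteq> {..<usize A ^ K}"
  shows "num_clause_holds A K (interp_of (usize A) K (relations_of (usize A) K L I)) vs c \<longleftrightarrow>
    num_clause_holds A K I vs c"
proof -
  have *: "num_atom_holds (usize A) (interp_of (usize A) K (relations_of (usize A) K L I)) vs a \<longleftrightarrow>
      num_atom_holds (usize A) I vs a" if "wf_num_atom L (length vs) K a" for a
    using that num_val_less[OF A _ vs] by (cases a) (simp add: interp_of_relations_of)
  show ?thesis
    using wf * by (cases c) (auto simp: list_all_iff)
qed

lemma wf_term_tuple:
  assumes "wf_num_term m K s"
  shows "list_all (wf_term \<sigma> (m * K)) (term_tuple K s)"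
proof (cases s)
  case (NVar i)
  have "i * K + l < m * K" if "l < K" for l
  proof -
    have "i * K + l < Suc i * K" using that by simp
    also have "\<dots> \<le> m * K" using assms NVar by (intro mult_right_mono) auto
    finally show ?thesis .
  qed
  then show ?thesis using NVar by (auto simp: list_all_iff)
next
  case (NMax a)
  then show ?thesis by (auto simp: list_all_iff)
qed

lemma length_term_tuple: "wf_num_term m K s \<Longrightarrow> length (term_tuple K s) = K"
  by (cases s) auto

lemma wf_atom_of:
  "wf_num_atom L m K a \<Longrightarrow> wf_atom \<sigma> (replicate L (2 * K)) (m * K) (atom_of K a)"
  by (cases a) (auto simp: wf_term_tuple length_term_tuple)

lemma wf_literal_first_order: "wf_literal \<sigma> [] m l \<Longrightarrow> wf_literal \<sigma> \<tau> m l \<and> \<not> positive_SO l"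
  by (cases "(\<sigma>, [] :: nat list, m, l)" rule: wf_literal.cases; rename_tac a; case_tac a) auto

lemma wf_clause_of:
  assumes "wf_num_clause \<sigma> L m K c"
  shows "list_all (wf_literal \<sigma> (replicate L (2 * K)) (m * K)) (clause_of K c)"
    and "horn_clause (clause_of K c)"
proof -
  obtain fo body head where c: "c = NClause fo body head" by (cases c)
  show "list_all (wf_literal \<sigma> (replicate L (2 * K)) (m * K)) (clause_of K c)"
    using assms wf_literal_first_order[of \<sigma> "m * K"]
    by (auto simp: c list_all_iff simp del: wf_atom.simps atom_of.simps split: option.splits
        intro!: wf_atom_of)
  have "filter positive_SO fo = []"
    using assms wf_literal_first_order[of \<sigma> "m * K"] by (auto simp: c list_all_iff filter_empty_conv)
  then show "horn_clause (clause_of K c)"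
    by (auto simp: c horn_clause_def filter_map o_def split: option.splits)
qed

text \<open>
  The successor relation on digit tuples as a disjunction of conjunctions, one for each position of
  the digit that is incremented.
\<close>

fun next_conditions :: "fo_term list \<Rightarrow> fo_term list \<Rightarrow> atom list list" where
  "next_conditions (s # ss) (t # ts) =
     (Succ s t # map (\<lambda>u. Eq u Last) ss @ map (\<lambda>u. Eq u First) ts) #
     map (Cons (Eq s t)) (next_conditions ss ts)"
| "next_conditions _ _ = []"

lemma next_conditions_sat:
  "(\<exists>C \<in> set (next_conditions ss ts). \<forall>a \<in> set C. sat_atom A S e a) \<longleftrightarrow>
    lex_next (usize A) (map (eval_term A e) ss) (map (eval_term A e) ts)"
  by (induction ss ts rule: next_conditions.induct)
    (auto simp: ball_Un)

lemma next_conditions_wf: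
  "list_all (wf_term \<sigma> m) ss \<Longrightarrow> list_all (wf_term \<sigma> m) ts \<Longrightarrow> C \<in> set (next_conditions ss ts) \<Longrightarrow>
    list_all (wf_atom \<sigma> \<tau> m) C"
  by (induction ss ts arbitrary: C rule: next_conditions.induct) (auto simp: list_all_iff)


section \<open>The encoded structure as a word\<close>

text \<open>
  The initial tape is cut into blocks, one per relation or constant symbol, each listing the values of
  one atom along the tuples of a fixed arity. The word \<open>0\<^sup>n1\<close> gives the blocks \<open>BFalse\<close> and \<open>BTrue\<close>,
  and \<open>BBlank\<close> is a final stretch of \<open>n ^ K\<close> blank cells.
\<close>

datatype block = BFalse | BTrue | BRel nat | BConst nat | BBlank

definition blocks :: "vocabulary \<Rightarrow> block list" where
  "blocks \<sigma> =
     [BFalse, BTrue] @ map BRel [0..<length (rel_arities \<sigma>)] @ map BConst [0..<nconsts \<sigma>] @ [BBlank]"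

fun block_arity :: "vocabulary \<Rightarrow> nat \<Rightarrow> block \<Rightarrow> nat" where
  "block_arity \<sigma> K BFalse = 1"
| "block_arity \<sigma> K BTrue = 0"
| "block_arity \<sigma> K (BRel j) = rel_arities \<sigma> ! j"
| "block_arity \<sigma> K (BConst c) = 1"
| "block_arity \<sigma> K BBlank = K"

fun block_bit :: "vocabulary \<Rightarrow> fin_structure \<Rightarrow> block \<Rightarrow> nat \<Rightarrow> bool" where
  "block_bit \<sigma> A BFalse x \<longleftrightarrow> False"
| "block_bit \<sigma> A BTrue x \<longleftrightarrow> True"
| "block_bit \<sigma> A (BRel j) x \<longleftrightarrow> digits (usize A) (rel_arities \<sigma> ! j) x \<in> rels A ! j"
| "block_bit \<sigma> A (BConst c) x \<longleftrightarrow> x = const_vals A ! c"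
| "block_bit \<sigma> A BBlank x \<longleftrightarrow> False"

fun block_symbol :: "block \<Rightarrow> bool \<Rightarrow> nat" where
  "block_symbol BBlank v = 0"
| "block_symbol b v = bit_symbol v"

text \<open>Variable 1 is the position within the block. For a constant it is below
  \<open>n\<close>, so its last digit is the element itself. The default
  \<open>Succ First First\<close> is a false atom, used for \<open>BFalse\<close> and
  \<open>BBlank\<close>.\<close>

fun block_atom :: "vocabulary \<Rightarrow> nat \<Rightarrow> block \<Rightarrow> atom" where
  "block_atom \<sigma> K BTrue = Eq First First"
| "block_atom \<sigma> K (BRel j) = Rel j (drop (K - rel_arities \<sigma> ! j) (term_tuple K (NVar 1)))"
| "block_atom \<sigma> K (BConst c) = Eq (last (term_tuple K (NVar 1))) (Const c)"
| "block_atom \<sigma> K _ = Succ First First"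

definition block_word :: "vocabulary \<Rightarrow> fin_structure \<Rightarrow> nat \<Rightarrow> block \<Rightarrow> nat list" where
  "block_word \<sigma> A K b =
     map (\<lambda>x. block_symbol b (block_bit \<sigma> A b x)) [0..<usize A ^ block_arity \<sigma> K b]"

definition input_word :: "vocabulary \<Rightarrow> fin_structure \<Rightarrow> nat \<Rightarrow> nat list" where
  "input_word \<sigma> A K = concat (map (block_word \<sigma> A K) (blocks \<sigma>))"

definition block_offset :: "vocabulary \<Rightarrow> fin_structure \<Rightarrow> nat \<Rightarrow> nat \<Rightarrow> nat" where
  "block_offset \<sigma> A K j = length (concat (map (block_word \<sigma> A K) (take j (blocks \<sigma>))))"

lemma length_block_word [simp]: "length (block_word \<sigma> A K b) = usize A ^ block_arity \<sigma> K b"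
  by (simp add: block_word_def)

lemma block_offset_0: "block_offset \<sigma> A K 0 = 0"
  by (simp add: block_offset_def)

lemma block_offset_Suc:
  "j < length (blocks \<sigma>) \<Longrightarrow>
    block_offset \<sigma> A K (Suc j) = block_offset \<sigma> A K j + usize A ^ block_arity \<sigma> K (blocks \<sigma> ! j)"
  by (simp add: block_offset_def take_Suc_conv_app_nth)

lemma nth_concat_offset:
  "j < length xss \<Longrightarrow> x < length (xss ! j) \<Longrightarrow>
    concat xss ! (length (concat (take j xss)) + x) = xss ! j ! x"
proof (induction xss arbitrary: j)
  case (Cons xs xss)
  then show ?case by (cases j) (simp_all add: nth_append add.assoc)
qed simp

lemma concat_offset_cases:
  assumes "p < length (concat xss)"
  shows "\<exists>j x. j < length xss \<and> x < length (xss ! j) \<and> p = length (concat (take j xss)) + x"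
  using assms
proof (induction xss arbitrary: p)
  case (Cons xs xss)
  show ?case
  proof (cases "p < length xs")
    case True
    then show ?thesis by (intro exI[of _ 0] exI[of _ p]) simp
  next
    case False
    then have "p - length xs < length (concat xss)" using Cons.prems by simp
    then obtain j x where "j < length xss" "x < length (xss ! j)"
        "p - length xs = length (concat (take j xss)) + x"
      using Cons.IH by blast
    then show ?thesis using False by (intro exI[of _ "Suc j"] exI[of _ x]) simp
  qed
qed simp

lemma nth_input_word:
  assumes "j < length (blocks \<sigma>)" "x < usize A ^ block_arity \<sigma> K (blocks \<sigma> ! j)"
  shows "input_word \<sigma> A K ! (block_offset \<sigma> A K j + x) =
    block_symbol (blocks \<sigma> ! j) (block_bit \<sigma> A (blocks \<sigma> ! j) x)"
  using assms nth_concat_offset[of j "map (block_word \<sigma> A K) (blocks \<sigma>)" x]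
  by (simp add: input_word_def block_offset_def take_map) (simp add: block_word_def)

lemma input_word_cases:
  assumes "p < length (input_word \<sigma> A K)"
  obtains j x where "j < length (blocks \<sigma>)" "x < usize A ^ block_arity \<sigma> K (blocks \<sigma> ! j)"
    "p = block_offset \<sigma> A K j + x"
  using concat_offset_cases[of p "map (block_word \<sigma> A K) (blocks \<sigma>)"] assms that
  by (auto simp: input_word_def block_offset_def take_map)

lemma map2_conv_nth:
  "length xs = length ys \<Longrightarrow> map2 f xs ys = map (\<lambda>j. f (xs ! j) (ys ! j)) [0..<length ys]"
  by (rule nth_equalityI) auto

text \<open>Justifies the cutting into blocks; the relation parts agree by
  \<open>product_lists_digits\<close>.\<close>

lemma input_word_eq:
  assumes "A \<in> structures \<sigma>"
  shows "input_word \<sigma> A K = map bit_symbol (encode \<sigma> A) @ replicate (usize A ^ K) 0"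
proof -
  have "length (rels A) = length (rel_arities \<sigma>)" "length (const_vals A) = nconsts \<sigma>"
    using assms by (auto simp: structures_def interpretations_def)
  moreover have "map f (const_vals A) = map (\<lambda>c. f (const_vals A ! c)) [0..<length (const_vals A)]"
    for f :: "nat \<Rightarrow> bool list"
    by (rule nth_equalityI) auto
  ultimately show ?thesis
    by (simp add: input_word_def blocks_def encode_def Let_def map2_conv_nth block_word_def
        product_lists_digits map_concat o_def map_replicate_const)
qed

lemma map_eval_var_tuple:
  assumes "1 < length vs"
  shows "map (eval_term A (digit_env A K vs)) (term_tuple K (NVar 1)) = digits (usize A) K (vs ! 1)"
  using nth_concat_digits[of 1 vs _ K "usize A"] assms
    map_nth[of "digits (usize A) K (vs ! 1)"]
  by (auto simp: digit_env_def intro!: nth_equalityI)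

lemma last_digits: "0 < k \<Longrightarrow> last (digits n k x) = x mod n"
proof (induction k)
  case (Suc k)
  then show ?case by (cases k) auto
qed simp

lemma sat_block_atom:
  assumes "1 < length vs" "0 < K" "block_arity \<sigma> K b \<le> K" "vs ! 1 < usize A ^ block_arity \<sigma> K b"
  shows "sat_atom A S (digit_env A K vs) (block_atom \<sigma> K b) \<longleftrightarrow> block_bit \<sigma> A b (vs ! 1)"
proof (cases b)
  case (BRel j)
  have "map (eval_term A (digit_env A K vs)) (drop (K - rel_arities \<sigma> ! j) (term_tuple K (NVar 1))) =
      digits (usize A) (rel_arities \<sigma> ! j) (vs ! 1)"
    using assms(3) BRel
    unfolding drop_map[symmetric] map_eval_var_tuple[OF assms(1)] by (simp add: drop_digits)
  then show ?thesis using BRel by simp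
next
  case (BConst c)
  have "eval_term A (digit_env A K vs) (last (term_tuple K (NVar 1))) = last (digits (usize A) K (vs ! 1))"
    using assms(2) by (subst map_eval_var_tuple[OF assms(1), symmetric], subst last_map) auto
  then show ?thesis using BConst assms by (simp add: last_digits)
qed auto

lemma wf_block_atom:
  assumes "b \<in> set (blocks \<sigma>)" "1 < m" "0 < K" "block_arity \<sigma> K b \<le> K"
  shows "wf_atom \<sigma> \<tau> (m * K) (block_atom \<sigma> K b)"
proof -
  have *: "list_all (wf_term \<sigma> (m * K)) (term_tuple K (NVar 1))"
    using assms(2) by (intro wf_term_tuple) simp
  then have "wf_term \<sigma> (m * K) (last (term_tuple K (NVar 1)))"
    using assms(3) length_term_tuple[of 2 K "NVar 1"] last_in_set[of "term_tuple K (NVar 1)"]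
    by (fastforce simp: list_all_iff simp del: term_tuple.simps)
  moreover have "list_all (wf_term \<sigma> (m * K)) (drop i (term_tuple K (NVar 1)))" for i
    using * by (auto simp: list_all_iff simp del: term_tuple.simps dest: in_set_dropD)
  ultimately show ?thesis
    using assms by (cases b) (auto simp: blocks_def length_term_tuple[of 2])
qed

section \<open>Values of binary words\<close>

definition bin_val :: "bool list \<Rightarrow> nat" where
  "bin_val y = foldl (\<lambda>v b. 2 * v + of_bool b) 0 y"

text \<open>The recursion shared by \<open>binary\<close> and the \<open>Val\<close> rules: reading
  one more bit doubles the value.\<close>

lemma bin_val_snoc: "bin_val (y @ [b]) = 2 * bin_val y + of_bool b"
  by (simp add: bin_val_def)

lemma bin_val_take_Suc:
  "i < length y \<Longrightarrow> bin_val (take (Suc i) y) = 2 * bin_val (take i y) + of_bool (y ! i)"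
  by (simp add: take_Suc_conv_app_nth bin_val_snoc)

text \<open>Keeps every intermediate value of the evaluation representable once the final one
  is.\<close>

lemma bin_val_take_le: "bin_val (take i y) \<le> bin_val y"
proof (induction y rule: rev_induct)
  case (snoc b y)
  then show ?case
    by (cases "i \<le> length y") (auto simp: bin_val_snoc)
qed simp

lemma bin_val_binary: "bin_val (binary v) = v"
proof (induction v rule: binary.induct)
  case (1 v)
  then show ?case
    by (cases "v = 0") (subst binary.simps, simp add: bin_val_snoc bin_val_def[of "[]"])+
qed

text \<open>A crude bound is enough: an optimum below \<open>n ^ K\<close> puts the blank that ends
  the output among the first \<open>n ^ K\<close> cells.\<close>

lemma length_binary_le: "length (binary v) \<le> v"
proof (induction v rule: binary.induct)
  case (1 v)
  show ?case
  proof (cases "v = 0")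
    case False
    then have "length (binary v) \<le> Suc (v div 2)"
      using 1 by (subst binary.simps) simp
    also have "\<dots> \<le> v" using False by presburger
    finally show ?thesis .
  qed (simp add: binary.simps)
qed

section \<open>Bounds by powers of the universe size\<close>

lemma poly_nat_mono: "x \<le> y \<Longrightarrow> poly p x \<le> poly p y" for p :: "nat poly"
  by (induction p) (auto intro: add_mono mult_mono)

lemma less_power_of_le: "2 \<le> n \<Longrightarrow> k < n ^ k" for n k :: nat
  using less_exp[of k] power_mono[of 2 n k] by linarith

lemma poly_nat_power_bound: "\<exists>d. \<forall>n\<ge>2. poly p (n ^ b) < n ^ d" for p :: "nat poly"
proof (induction p)
  case 0
  then show ?case by (auto intro!: exI[of _ 0])
next
  case (pCons a p)
  then obtain d where d: "\<forall>n\<ge>2. poly p (n ^ b) < n ^ d" by blast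
  \<comment> \<open>The summand \<open>a\<close> absorbs the constant coefficient via
    \<open>a < n ^ a\<close>, \<open>b + d\<close> absorbs the product, and the extra factor
    \<open>n\<close>, at least 2, absorbs the sum of the two terms.\<close>
  have "poly (pCons a p) (n ^ b) < n ^ (Suc (a + (b + d)))" if n: "2 \<le> n" for n
  proof -
    have "a < n ^ a" by (rule less_power_of_le[OF n])
    also have "\<dots> \<le> n ^ (a + (b + d))" using n by (intro power_increasing) auto
    finally have "a < n ^ (a + (b + d))" .
    moreover have "n ^ b * poly p (n ^ b) \<le> n ^ b * n ^ d" using d n by (simp add: less_imp_le)
    moreover have "n ^ b * n ^ d \<le> n ^ (a + (b + d))"
      unfolding power_add[symmetric] using n by (intro power_increasing) auto
    moreover have "2 * n ^ (a + (b + d)) \<le> n ^ Suc (a + (b + d))" using n by simp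
    ultimately show ?thesis unfolding poly_pCons by linarith
  qed
  then show ?case by blast
qed

lemma length_encode_bound: "\<exists>d. \<forall>A \<in> structures \<sigma>. length (encode \<sigma> A) < usize A ^ d"
proof -
  have sum_le: "\<exists>d. \<forall>n\<ge>(2 :: nat). (\<Sum>a\<leftarrow>as. n ^ a) < n ^ d" for as :: "nat list"
  proof (induction as)
    case Nil
    show ?case by (auto intro!: exI[of _ 0])
  next
    case (Cons a as)
    then obtain d where d: "\<forall>n\<ge>(2 :: nat). (\<Sum>a\<leftarrow>as. n ^ a) < n ^ d" by blast
    have "(\<Sum>a\<leftarrow>a # as. n ^ a) < n ^ Suc (a + d)" if n: "2 \<le> n" for n :: nat
    proof -
      have "n ^ a \<le> n ^ (a + d)" "n ^ d \<le> n ^ (a + d)" using n by (auto intro!: power_increasing)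
      moreover have "2 * n ^ (a + d) \<le> n ^ Suc (a + d)" using n by simp
      moreover have "(\<Sum>a\<leftarrow>as. n ^ a) < n ^ d" using d n by blast
      ultimately show ?thesis unfolding list.map sum_list.Cons by linarith
    qed
    then show ?case by blast
  qed
  \<comment> \<open>Taking \<open>K = 0\<close> shrinks the blank block to one cell, so the input
    word is barely longer than the encoding and its block arities depend on the vocabulary
    alone.\<close>
  obtain d where d: "\<forall>n\<ge>(2 :: nat). (\<Sum>a\<leftarrow>map (block_arity \<sigma> 0) (blocks \<sigma>). n ^ a) < n ^ d"
    using sum_le by blast
  have "length (encode \<sigma> A) < usize A ^ d" if A: "A \<in> structures \<sigma>" for A
  proof -
    have "length (encode \<sigma> A) \<le> length (input_word \<sigma> A 0)"
      by (simp add: input_word_eq[OF A])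
    also have "\<dots> = (\<Sum>a\<leftarrow>map (block_arity \<sigma> 0) (blocks \<sigma>). usize A ^ a)"
      by (simp add: input_word_def length_concat o_def)
    also have "\<dots> < usize A ^ d" using d A by (simp add: structures_def)
    finally show ?thesis .
  qed
  then show ?thesis by blast
qed


section \<open>The Horn program\<close>

abbreviation rule :: "num_atom list \<Rightarrow> num_atom \<Rightarrow> num_clause" where
  "rule body head \<equiv> NClause [] body (Some head)"

abbreviation X :: "nat \<Rightarrow> num_term" where
  "X \<equiv> NVar"

abbreviation zero :: num_term where
  "zero \<equiv> NMax 0"

text \<open>Variable 0 is reserved for \<open>w\<close>; the definite clauses use only 1 to 5, and
  these five numbers make up \<open>x\<close>. \<open>Next\<close> gets one clause per disjunct of
  the successor condition.\<close>

definition arithmetic_clauses :: "nat \<Rightarrow> num_clause list" where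
  "arithmetic_clauses K =
     map (\<lambda>C. NClause (map Neg C) [] (Some (Next, X 1, X 2)))
       (next_conditions (term_tuple K (X 1)) (term_tuple K (X 2))) @
     [rule [(Next, X 1, X 2)] (Less, X 1, X 2),
      rule [(Less, X 1, X 2), (Next, X 2, X 3)] (Less, X 1, X 3),
      rule [] (Double, zero, zero),
      rule [(Double, X 1, X 2), (Next, X 1, X 3), (Next, X 2, X 4), (Next, X 4, X 5)] (Double, X 3, X 5)]"

text \<open>The bound in the \<open>Less\<close> guard is the last position of the block, so the
  advanced position is still inside it. The block atom occurs with both signs, which the Horn
  condition allows for first-order atoms, so both symbols are derivable.\<close>

definition block_clauses :: "vocabulary \<Rightarrow> nat \<Rightarrow> nat \<Rightarrow> num_clause list" where
  "block_clauses \<sigma> K j =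
     (let b = blocks \<sigma> ! j in
      [rule [(Inp j, X 1, X 2), (Less, X 1, NMax (block_arity \<sigma> K b)), (Next, X 1, X 3), (Next, X 2, X 4)]
         (Inp j, X 3, X 4),
       NClause [Neg (block_atom \<sigma> K b)] [(Inp j, X 1, X 2)]
         (Some (Tape (block_symbol b True), zero, X 2)),
       NClause [Pos (block_atom \<sigma> K b)] [(Inp j, X 1, X 2)]
         (Some (Tape (block_symbol b False), zero, X 2))])"

definition block_link :: "vocabulary \<Rightarrow> nat \<Rightarrow> nat \<Rightarrow> num_clause" where
  "block_link \<sigma> K j =
     rule [(Inp j, NMax (block_arity \<sigma> K (blocks \<sigma> ! j)), X 1), (Next, X 1, X 2)] (Inp (Suc j), zero, X 2)"

definition input_clauses :: "vocabulary \<Rightarrow> nat \<Rightarrow> num_clause list" where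
  "input_clauses \<sigma> K =
     [rule [] (Head 0, zero, zero), rule [] (Inp 0, zero, zero)] @
     map (block_link \<sigma> K) [0..<length (blocks \<sigma>) - 1] @
     concat (map (block_clauses \<sigma> K) [0..<length (blocks \<sigma>)])"

text \<open>Halting becomes an idle move, so that the final tape can be read off at time \<open>N - 1\<close>.\<close>

definition machine_move :: "machine \<Rightarrow> nat \<Rightarrow> nat \<Rightarrow> nat \<times> nat \<times> move" where
  "machine_move M q a = (if q = halt_state M then (q, a, Stay) else trans M q a)"

text \<open>A left move needs a second rule for cell 0, which has no predecessor and where the head
  stays.\<close>

fun head_clauses :: "nat \<Rightarrow> nat \<Rightarrow> nat \<Rightarrow> move \<Rightarrow> num_clause list" where
  "head_clauses q a q' Stay =
     [rule [(Head q, X 1, X 2), (Tape a, X 1, X 2), (Next, X 1, X 3)] (Head q', X 3, X 2)]"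
| "head_clauses q a q' MoveRight =
     [rule [(Head q, X 1, X 2), (Tape a, X 1, X 2), (Next, X 1, X 3), (Next, X 2, X 4)] (Head q', X 3, X 4)]"
| "head_clauses q a q' MoveLeft =
     [rule [(Head q, X 1, X 2), (Tape a, X 1, X 2), (Next, X 1, X 3), (Next, X 4, X 2)] (Head q', X 3, X 4),
      rule [(Head q, X 1, zero), (Tape a, X 1, zero), (Next, X 1, X 3)] (Head q', X 3, zero)]"

text \<open>In the first rule \<open>a\<close> is the scanned symbol. In the two frame rules it is
  the symbol of another cell \<open>X 4\<close>, which lies right or left of the head and is copied
  whatever the transition is.\<close>

definition transition_clauses :: "machine \<Rightarrow> nat \<Rightarrow> nat \<Rightarrow> num_clause list" where
  "transition_clauses M q a =
     (case machine_move M q a of (q', a', d) \<Rightarrow>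
        [rule [(Head q, X 1, X 2), (Tape a, X 1, X 2), (Next, X 1, X 3)] (Tape a', X 3, X 2),
         rule [(Head q, X 1, X 2), (Tape a, X 1, X 4), (Less, X 2, X 4), (Next, X 1, X 3)] (Tape a, X 3, X 4),
         rule [(Head q, X 1, X 2), (Tape a, X 1, X 4), (Less, X 4, X 2), (Next, X 1, X 3)] (Tape a, X 3, X 4)] @
        head_clauses q a q' d)"

definition machine_clauses :: "machine \<Rightarrow> num_clause list" where
  "machine_clauses M =
     concat (map (\<lambda>q. concat (map (transition_clauses M q) [0..<nsymbols M])) [0..<nstates M])"

text \<open>\<open>NMax K\<close> is the time \<open>n ^ K - 1\<close>. Symbols 1 and 2 are the
  bits; at the blank ending the word the accumulated value is complete and becomes the first bad
  number.\<close>

definition output_clauses :: "nat \<Rightarrow> num_clause list" where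
  "output_clauses K =
     [rule [] (Val, zero, zero),
      rule [(Val, X 1, X 2), (Tape 1, NMax K, X 1), (Next, X 1, X 3), (Double, X 2, X 4)] (Val, X 3, X 4),
      rule [(Val, X 1, X 2), (Tape 2, NMax K, X 1), (Next, X 1, X 3), (Double, X 2, X 4), (Next, X 4, X 5)]
        (Val, X 3, X 5),
      rule [(Val, X 1, X 2), (Tape 0, NMax K, X 1)] (Bad, X 2, zero),
      rule [(Bad, X 1, zero), (Next, X 1, X 2)] (Bad, X 2, zero)]"

definition definite_clauses :: "vocabulary \<Rightarrow> nat \<Rightarrow> machine \<Rightarrow> num_clause list" where
  "definite_clauses \<sigma> K M =
     arithmetic_clauses K @ input_clauses \<sigma> K @ machine_clauses M @ output_clauses K"

definition goal_clause :: num_clause where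
  "goal_clause = NClause [] [(Bad, X 0, zero)] None"

section \<open>Runs of the machine\<close>

definition run :: "machine \<Rightarrow> bool list \<Rightarrow> nat \<Rightarrow> config" where
  "run M x t = (step M ^^ t) (init_config x)"

abbreviation state_at :: "machine \<Rightarrow> bool list \<Rightarrow> nat \<Rightarrow> nat" where
  "state_at M x t \<equiv> fst (run M x t)"

abbreviation head_at :: "machine \<Rightarrow> bool list \<Rightarrow> nat \<Rightarrow> nat" where
  "head_at M x t \<equiv> fst (snd (run M x t))"

abbreviation tape_at :: "machine \<Rightarrow> bool list \<Rightarrow> nat \<Rightarrow> nat \<Rightarrow> nat" where
  "tape_at M x t \<equiv> snd (snd (run M x t))"

lemma step_machine_move:
  "step M (q, h, f) = (case machine_move M q (f h) of (q', a, d) \<Rightarrow> (q', move_head d h, f(h := a)))"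
  by (simp add: step_def machine_move_def)

lemma run_0: "run M x 0 = init_config x"
  by (simp add: run_def)

lemma run_Suc:
  assumes "machine_move M (state_at M x t) (tape_at M x t (head_at M x t)) = (q', a, d)"
  shows "run M x (Suc t) = (q', move_head d (head_at M x t), (tape_at M x t)(head_at M x t := a))"
proof -
  obtain q h f where r: "run M x t = (q, h, f)" by (cases "run M x t")
  have "run M x (Suc t) = step M (run M x t)" by (simp add: run_def)
  also have "\<dots> = (case machine_move M q (f h) of (q', a, d) \<Rightarrow> (q', move_head d h, f(h := a)))"
    unfolding r by (rule step_machine_move)
  finally show ?thesis using assms by (simp add: r)
qed

text \<open>Keeps the head on representable cells for as long as the time is representable.\<close>

lemma head_at_le: "head_at M x t \<le> t"
proof (induction t)
  case (Suc t)
  obtain q' a d where m: "machine_move M (state_at M x t) (tape_at M x t (head_at M x t)) = (q', a, d)"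
    by (metis prod.exhaust)
  show ?case using Suc unfolding run_Suc[OF m] by (cases d) auto
qed (simp add: run_0 init_config_def)

lemma machine_move_wf:
  assumes "wf_machine M" "q < nstates M" "a < nsymbols M" "machine_move M q a = (q', a', d)"
  shows "q' < nstates M \<and> a' < nsymbols M"
proof (cases "q = halt_state M")
  case False
  have "case trans M q a of (q', a', d) \<Rightarrow> q' < nstates M \<and> a' < nsymbols M"
    using assms(1)[unfolded wf_machine_def] assms(2,3) by (elim conjE allE[of _ q] allE[of _ a]) simp
  then show ?thesis using assms(4) False by (simp add: machine_move_def)
qed (use assms(2-4) in \<open>simp add: machine_move_def\<close>)

lemma run_wf:
  assumes "wf_machine M"
  shows "state_at M x t < nstates M \<and> tape_at M x t p < nsymbols M"
proof (induction t arbitrary: p)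
  case 0
  show ?case using assms by (auto simp: run_0 init_config_def wf_machine_def bit_symbol_def)
next
  case (Suc t)
  obtain q' a d where m: "machine_move M (state_at M x t) (tape_at M x t (head_at M x t)) = (q', a, d)"
    by (metis prod.exhaust)
  have "q' < nstates M \<and> a < nsymbols M"
    by (rule machine_move_wf[OF assms _ _ m]) (use Suc in auto)
  then show ?case using Suc unfolding run_Suc[OF m] by simp
qed

lemma run_halted:
  assumes "state_at M x t = halt_state M" "t \<le> t'"
  shows "run M x t' = run M x t"
  using assms(2)
proof (induction t' rule: dec_induct)
  case (step t')
  have "step M (run M x t) = run M x t"
    using assms(1) by (cases "run M x t") (simp add: step_def)
  then show ?case using step by (simp add: run_def)
qed simp

text \<open>A halted configuration repeats, so an output present by time \<open>T\<close> can be
  read at any later time.\<close>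

lemma outputs_within_run:
  assumes "outputs_within M x T y" "T \<le> t"
  shows "\<forall>i < length y. tape_at M x t i = bit_symbol (y ! i)" "tape_at M x t (length y) = 0"
proof -
  obtain t' where t': "t' \<le> T" "case run M x t' of (q, h, tape) \<Rightarrow>
        q = halt_state M \<and> (\<forall>i < length y. tape i = bit_symbol (y ! i)) \<and> tape (length y) = 0"
    using assms(1) unfolding outputs_within_def run_def[symmetric] by (elim exE conjE) (rule that)
  obtain q h f where r: "run M x t' = (q, h, f)" by (cases "run M x t'")
  have "run M x t = (q, h, f)"
    using run_halted[of M x t' t] t' assms(2) by (simp add: r)
  then show "\<forall>i < length y. tape_at M x t i = bit_symbol (y ! i)" "tape_at M x t (length y) = 0"
    using t'(2) by (simp_all add: r)
qed

definition num_preds :: "vocabulary \<Rightarrow> machine \<Rightarrow> nat" where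
  "num_preds \<sigma> M = 5 + 3 * (length (blocks \<sigma>) + nstates M + nsymbols M)"

lemma blocks_not_Nil: "0 < length (blocks \<sigma>)"
  by (simp add: blocks_def)

lemma block_symbol_less: "wf_machine M \<Longrightarrow> block_symbol b v < nsymbols M"
  unfolding wf_machine_def by (cases b) (simp_all add: bit_symbol_def)

lemma definite_clauses_wf:
  assumes K: "0 < K" "\<forall>b \<in> set (blocks \<sigma>). block_arity \<sigma> K b \<le> K" and M: "wf_machine M"
    and c: "c \<in> set (definite_clauses \<sigma> K M)"
  shows "wf_num_clause \<sigma> (num_preds \<sigma> M) 6 K c"
proof -
  have preds: "pred_index Next < num_preds \<sigma> M" "pred_index Less < num_preds \<sigma> M"
      "pred_index Double < num_preds \<sigma> M" "pred_index Val < num_preds \<sigma> M"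
      "pred_index Bad < num_preds \<sigma> M"
      "j < length (blocks \<sigma>) \<Longrightarrow> pred_index (Inp j) < num_preds \<sigma> M"
      "a < nsymbols M \<Longrightarrow> pred_index (Tape a) < num_preds \<sigma> M"
      "q < nstates M \<Longrightarrow> pred_index (Head q) < num_preds \<sigma> M" for j a q
    using M by (auto simp: num_preds_def wf_machine_def)
  consider "c \<in> set (arithmetic_clauses K)" | "c \<in> set (input_clauses \<sigma> K)"
    | "c \<in> set (machine_clauses M)" | "c \<in> set (output_clauses K)"
    using c by (auto simp: definite_clauses_def)
  then show ?thesis
  proof cases
    case 1
    have "list_all (wf_atom \<sigma> [] (6 * K)) C"
      if "C \<in> set (next_conditions (term_tuple K (X 1)) (term_tuple K (X 2)))" for C
      by (rule next_conditions_wf[OF wf_term_tuple wf_term_tuple that]) simp_all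
    then show ?thesis
      using 1 preds by (auto simp: arithmetic_clauses_def list_all_iff simp del: pred_index.simps term_tuple.simps)
  next
    case 2
    have "wf_atom \<sigma> [] (6 * K) (block_atom \<sigma> K (blocks \<sigma> ! j))" "block_arity \<sigma> K (blocks \<sigma> ! j) \<le> K"
      if "j < length (blocks \<sigma>)" for j
      using that K by (auto intro: wf_block_atom)
    then show ?thesis
      using 2 preds block_symbol_less[OF M] blocks_not_Nil[of \<sigma>] M
      by (auto simp: input_clauses_def block_clauses_def block_link_def Let_def wf_machine_def
          simp del: pred_index.simps)
  next
    case 3
    then obtain q a where qa: "q < nstates M" "a < nsymbols M" "c \<in> set (transition_clauses M q a)"
      by (auto simp: machine_clauses_def)
    obtain q' a' d where m: "machine_move M q a = (q', a', d)" by (metis prod.exhaust)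
    show ?thesis
      using qa machine_move_wf[OF M qa(1,2) m] preds
      by (cases d) (auto simp: transition_clauses_def m simp del: pred_index.simps)
  next
    case 4
    then show ?thesis
      using preds M by (auto simp: output_clauses_def wf_machine_def simp del: pred_index.simps)
  qed
qed


section \<open>The intended interpretation\<close>

text \<open>\<open>y\<close> is the output word. The strict bounds by \<open>usize A ^ K\<close>
  make every cell, time and value that the derivations need a representable number.\<close>

locale simulation =
  fixes \<sigma> :: vocabulary and A :: fin_structure and M :: machine and K :: nat and y :: "bool list"
  assumes structure_A: "A \<in> structures \<sigma>"
    and wf_M: "wf_machine M"
    and K_pos: "0 < K"
    and arity_le: "\<forall>b \<in> set (blocks \<sigma>). block_arity \<sigma> K b \<le> K"
    and length_encode_less: "length (encode \<sigma> A) < usize A ^ K"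
    and output_bits: "\<forall>i < length y. tape_at M (encode \<sigma> A) (usize A ^ K - 1) i = bit_symbol (y ! i)"
    and output_end: "tape_at M (encode \<sigma> A) (usize A ^ K - 1) (length y) = 0"
    and length_y_less: "length y < usize A ^ K"
    and bin_val_y_less: "bin_val y < usize A ^ K"
begin

abbreviation n :: nat where
  "n \<equiv> usize A"

abbreviation N :: nat where
  "N \<equiv> n ^ K"

abbreviation enc :: "bool list" where
  "enc \<equiv> encode \<sigma> A"

text \<open>Given on all natural numbers, without truncation; \<open>relations_of\<close> later
  restricts it to numbers below \<open>N\<close>, where all clause variables range.\<close>

fun intended :: num_interp where
  "intended Next u v \<longleftrightarrow> v = Suc u"
| "intended Less u v \<longleftrightarrow> u < v"
| "intended Double u v \<longleftrightarrow> v = 2 * u"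
| "intended Val u v \<longleftrightarrow> u \<le> length y \<and> v = bin_val (take u y)"
| "intended Bad u v \<longleftrightarrow> bin_val y \<le> u"
| "intended (Inp j) u v \<longleftrightarrow>
     u < n ^ block_arity \<sigma> K (blocks \<sigma> ! j) \<and> v = block_offset \<sigma> A K j + u"
| "intended (Tape a) u v \<longleftrightarrow> tape_at M enc u v = a"
| "intended (Head q) u v \<longleftrightarrow> state_at M enc u = q \<and> head_at M enc u = v"

lemma n_ge: "2 \<le> n"
  using structure_A by (simp add: structures_def)

lemma N_pos: "0 < N"
  using n_ge by simp

text \<open>The purpose of the blank block: every cell below \<open>N\<close> lies in some block, so
  its initial content, blank or not, is derived by a rule.\<close>

lemma N_le_input_word: "N \<le> length (input_word \<sigma> A K)"
  by (simp add: input_word_eq[OF structure_A])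

lemma tape_at_0:
  assumes "p < N"
  shows "tape_at M enc 0 p = input_word \<sigma> A K ! p"
proof (cases "p < length enc")
  case True
  then show ?thesis
    by (simp add: run_0 init_config_def input_word_eq[OF structure_A] nth_append)
next
  case False
  then have "p - length enc < N" using assms by simp
  then show ?thesis using False
    by (simp add: run_0 init_config_def input_word_eq[OF structure_A] nth_append)
qed

lemma next_conditions_digits:
  assumes "2 < length vs" "vs ! 1 < N" "vs ! 2 < N"
  shows "(\<exists>C \<in> set (next_conditions (term_tuple K (X 1)) (term_tuple K (X 2))).
      \<forall>a \<in> set C. sat_atom A S (digit_env A K vs) a) \<longleftrightarrow> vs ! 2 = Suc (vs ! 1)"
  unfolding next_conditions_sat
  using assms by (simp add: map_eval_term_tuple n_ge lex_next_digits del: term_tuple.simps)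

lemma arithmetic_clauses_intended:
  assumes "length vs = 6" "\<And>i. i < 6 \<Longrightarrow> vs ! i < N" "c \<in> set (arithmetic_clauses K)"
  shows "num_clause_holds A K intended vs c"
proof -
  have "vs ! 2 = Suc (vs ! 1)"
    if "C \<in> set (next_conditions (term_tuple K (X 1)) (term_tuple K (X 2)))"
      "\<forall>a \<in> set C. sat_atom A [] (digit_env A K vs) a" for C
    using next_conditions_digits[of vs "[]"] assms(1,2) that by auto
  then have *: "num_clause_holds A K intended vs (NClause (map Neg C) [] (Some (Next, X 1, X 2)))"
    if "C \<in> set (next_conditions (term_tuple K (X 1)) (term_tuple K (X 2)))" for C
    using that by auto
  consider C where "C \<in> set (next_conditions (term_tuple K (X 1)) (term_tuple K (X 2)))"
      "c = NClause (map Neg C) [] (Some (Next, X 1, X 2))"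
    | "c \<in> {rule [(Next, X 1, X 2)] (Less, X 1, X 2),
      rule [(Less, X 1, X 2), (Next, X 2, X 3)] (Less, X 1, X 3),
      rule [] (Double, zero, zero),
      rule [(Double, X 1, X 2), (Next, X 1, X 3), (Next, X 2, X 4), (Next, X 4, X 5)] (Double, X 3, X 5)}"
    using assms(3) unfolding arithmetic_clauses_def by auto
  then show ?thesis
  proof cases
    case 1
    then show ?thesis using * by blast
  next
    case 2
    then show ?thesis by auto
  qed
qed

lemma block_clauses_intended:
  assumes "length vs = 6" "\<And>i. i < 6 \<Longrightarrow> vs ! i < N"
    and j: "j < length (blocks \<sigma>)" and c: "c \<in> set (block_clauses \<sigma> K j)"
  shows "num_clause_holds A K intended vs c"
proof -
  define b where "b = blocks \<sigma> ! j"
  have sat: "sat_atom A [] (digit_env A K vs) (block_atom \<sigma> K b) \<longleftrightarrow> block_bit \<sigma> A b (vs ! 1)"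
      "tape_at M enc 0 (vs ! 2) = block_symbol b (block_bit \<sigma> A b (vs ! 1))"
    if "intended (Inp j) (vs ! 1) (vs ! 2)"
  proof -
    have *: "vs ! 1 < n ^ block_arity \<sigma> K b" "vs ! 2 = block_offset \<sigma> A K j + vs ! 1"
      using that by (simp_all add: b_def)
    show "sat_atom A [] (digit_env A K vs) (block_atom \<sigma> K b) \<longleftrightarrow> block_bit \<sigma> A b (vs ! 1)"
      using * assms(1) arity_le j K_pos by (intro sat_block_atom) (auto simp: b_def)
    have "tape_at M enc 0 (vs ! 2) = input_word \<sigma> A K ! (block_offset \<sigma> A K j + vs ! 1)"
      using tape_at_0[of "vs ! 2"] assms(2)[of 2] *(2) by simp
    also have "\<dots> = block_symbol b (block_bit \<sigma> A b (vs ! 1))"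
      using nth_input_word[OF j, of "vs ! 1" A K] *(1) by (simp add: b_def)
    finally show "tape_at M enc 0 (vs ! 2) = block_symbol b (block_bit \<sigma> A b (vs ! 1))" .
  qed
  consider "c = rule [(Inp j, X 1, X 2), (Less, X 1, NMax (block_arity \<sigma> K b)), (Next, X 1, X 3),
      (Next, X 2, X 4)] (Inp j, X 3, X 4)"
    | "c = NClause [Neg (block_atom \<sigma> K b)] [(Inp j, X 1, X 2)]
        (Some (Tape (block_symbol b True), zero, X 2))"
    | "c = NClause [Pos (block_atom \<sigma> K b)] [(Inp j, X 1, X 2)]
        (Some (Tape (block_symbol b False), zero, X 2))"
    using c by (auto simp: block_clauses_def Let_def b_def)
  then show ?thesis
  proof cases
    case 1
    then show ?thesis by (auto simp: b_def)
  next
    case 2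
    show ?thesis
      using sat unfolding 2
      by (cases "intended (Inp j) (vs ! 1) (vs ! 2)"; cases "block_bit \<sigma> A b (vs ! 1)") simp_all
  next
    case 3
    show ?thesis
      using sat unfolding 3
      by (cases "intended (Inp j) (vs ! 1) (vs ! 2)"; cases "block_bit \<sigma> A b (vs ! 1)") simp_all
  qed
qed

lemma input_clauses_intended:
  assumes "length vs = 6" "\<And>i. i < 6 \<Longrightarrow> vs ! i < N" "c \<in> set (input_clauses \<sigma> K)"
  shows "num_clause_holds A K intended vs c"
proof -
  consider "c = rule [] (Head 0, zero, zero)" | "c = rule [] (Inp 0, zero, zero)"
    | j where "j \<in> {..<length (blocks \<sigma>) - 1}" "c = block_link \<sigma> K j"
    | j where "j \<in> {..<length (blocks \<sigma>)}" "c \<in> set (block_clauses \<sigma> K j)"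
  proof -
    have "set (input_clauses \<sigma> K) = {rule [] (Head 0, zero, zero), rule [] (Inp 0, zero, zero)} \<union>
        block_link \<sigma> K ` {..<length (blocks \<sigma>) - 1} \<union>
        (\<Union>j<length (blocks \<sigma>). set (block_clauses \<sigma> K j))"
      by (simp add: input_clauses_def lessThan_atLeast0)
    then have "c \<in> {rule [] (Head 0, zero, zero), rule [] (Inp 0, zero, zero)} \<union>
        block_link \<sigma> K ` {..<length (blocks \<sigma>) - 1} \<union>
        (\<Union>j<length (blocks \<sigma>). set (block_clauses \<sigma> K j))"
      using assms(3) by (rule subst)
    then show ?thesis
      by (elim UnE insertE emptyE imageE UN_E) (erule (1) that | erule that)+
  qed
  then show ?thesis
  proof cases
    case 1
    then show ?thesis by (simp add: run_0 init_config_def)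
  next
    case 2
    then show ?thesis using n_ge by (simp add: block_offset_0)
  next
    case (3 j)
    have "0 < n ^ block_arity \<sigma> K (blocks \<sigma> ! j)" "0 < n ^ block_arity \<sigma> K (blocks \<sigma> ! Suc j)"
      using n_ge by simp_all
    then have "vs ! 2 = block_offset \<sigma> A K (Suc j)"
      if "intended (Inp j) (n ^ block_arity \<sigma> K (blocks \<sigma> ! j) - 1) (vs ! 1)" "vs ! 2 = Suc (vs ! 1)"
      using that 3(1) by (simp add: block_offset_Suc)
    then have "intended (Inp (Suc j)) 0 (vs ! 2)"
      if "intended (Inp j) (n ^ block_arity \<sigma> K (blocks \<sigma> ! j) - 1) (vs ! 1)" "vs ! 2 = Suc (vs ! 1)"
      using that \<open>0 < n ^ block_arity \<sigma> K (blocks \<sigma> ! Suc j)\<close> by simp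
    then show ?thesis
      unfolding 3(2) block_link_def by (simp del: intended.simps(6))
  next
    case (4 j)
    then show ?thesis by (intro block_clauses_intended[OF assms(1,2)]) simp_all
  qed
qed

lemma transition_clauses_intended:
  assumes c: "c \<in> set (transition_clauses M q a)"
  shows "num_clause_holds A K intended vs c"
proof -
  obtain q' a' d where m: "machine_move M q a = (q', a', d)" by (metis prod.exhaust)
  have run: "run M enc (Suc t) = (q', move_head d (head_at M enc t), (tape_at M enc t)(head_at M enc t := a'))"
    if "state_at M enc t = q" "tape_at M enc t (head_at M enc t) = a" for t
    using that m by (intro run_Suc) simp
  \<comment> \<open>Stated for whatever transition actually happens, since in the frame rules
    \<open>a\<close> need not be the scanned symbol.\<close>
  have tape: "tape_at M enc (Suc t) p = tape_at M enc t p" if "p \<noteq> head_at M enc t" for t p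
  proof -
    obtain q1 a1 d1 where "machine_move M (state_at M enc t) (tape_at M enc t (head_at M enc t)) = (q1, a1, d1)"
      by (metis prod.exhaust)
    then show ?thesis using that by (simp add: run_Suc)
  qed
  consider "c = rule [(Head q, X 1, X 2), (Tape a, X 1, X 2), (Next, X 1, X 3)] (Tape a', X 3, X 2)"
    | "c = rule [(Head q, X 1, X 2), (Tape a, X 1, X 4), (Less, X 2, X 4), (Next, X 1, X 3)] (Tape a, X 3, X 4)"
    | "c = rule [(Head q, X 1, X 2), (Tape a, X 1, X 4), (Less, X 4, X 2), (Next, X 1, X 3)] (Tape a, X 3, X 4)"
    | "c \<in> set (head_clauses q a q' d)"
    using c by (auto simp: transition_clauses_def m)
  then show ?thesis
  proof cases
    case 4
    then show ?thesis
      using run[of "vs ! 1"] by (cases d) (auto simp del: fun_upd_apply)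
  qed (use run[of "vs ! 1"] tape[of _ "vs ! 1"] in auto)
qed

lemma output_clauses_intended:
  assumes c: "c \<in> set (output_clauses K)"
  shows "num_clause_holds A K intended vs c"
proof -
  \<comment> \<open>The symbol decides whether cell \<open>i\<close> is a bit or the end of the
    word, so the \<open>Val\<close> rules cannot run past the end and the \<open>Bad\<close> rule
    fires only there.\<close>
  have bit: "i < length y \<and> tape_at M enc (N - 1) i = bit_symbol (y ! i) \<or>
      i = length y \<and> tape_at M enc (N - 1) i = 0" if "i \<le> length y" for i
    using that output_bits output_end by (cases "i = length y") auto
  have succ: "bin_val (take (Suc i) y) = 2 * bin_val (take i y) + of_bool (tape_at M enc (N - 1) i = 2)"
    if "i < length y" for i
    using that output_bits by (simp add: bin_val_take_Suc bit_symbol_def)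
  consider "c = rule [] (Val, zero, zero)"
    | "c = rule [(Val, X 1, X 2), (Tape 1, NMax K, X 1), (Next, X 1, X 3), (Double, X 2, X 4)] (Val, X 3, X 4)"
    | "c = rule [(Val, X 1, X 2), (Tape 2, NMax K, X 1), (Next, X 1, X 3), (Double, X 2, X 4), (Next, X 4, X 5)]
        (Val, X 3, X 5)"
    | "c = rule [(Val, X 1, X 2), (Tape 0, NMax K, X 1)] (Bad, X 2, zero)"
    | "c = rule [(Bad, X 1, zero), (Next, X 1, X 2)] (Bad, X 2, zero)"
    using c unfolding output_clauses_def by auto
  then show ?thesis
  proof cases
    case 1
    then show ?thesis by (simp add: bin_val_def)
  next
    case 2
    then show ?thesis using bit[of "vs ! 1"] succ[of "vs ! 1"] by auto
  next
    case 3
    then show ?thesis using bit[of "vs ! 1"] succ[of "vs ! 1"] by auto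
  next
    case 4
    then show ?thesis using bit[of "vs ! 1"] by (auto simp: bit_symbol_def split: if_splits)
  next
    case 5
    then show ?thesis by auto
  qed
qed

lemma definite_clauses_intended:
  assumes "length vs = 6" "set vs \<subseteq> {..<N}" "c \<in> set (definite_clauses \<sigma> K M)"
  shows "num_clause_holds A K intended vs c"
proof -
  have less: "vs ! i < N" if "i < 6" for i
    using assms(1,2) that nth_mem[of i vs] by (auto simp del: nth_mem)
  show ?thesis
    using assms(3) arithmetic_clauses_intended[OF assms(1) less] input_clauses_intended[OF assms(1) less]
      transition_clauses_intended output_clauses_intended
    by (auto simp: definite_clauses_def machine_clauses_def)
qed

end


section \<open>Derivations in an arbitrary model\<close>

text \<open>\<open>w\<close> is one fixed value of variable 0: the clauses are known only for the
  tuple being counted, and this is enough because the definite clauses do not mention that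
  variable.\<close>

locale simulation_model = simulation +
  fixes I :: num_interp and w :: nat
  assumes clauses_hold:
    "\<And>vs c. length vs = 5 \<Longrightarrow> set vs \<subseteq> {..<N} \<Longrightarrow> c \<in> set (definite_clauses \<sigma> K M) \<Longrightarrow>
      num_clause_holds A K I (w # vs) c"
begin

text \<open>In its applications, variables absent from the clause are given the value 0.\<close>

lemma clause_instance:
  assumes "c \<in> set (definite_clauses \<sigma> K M)" "v1 < N" "v2 < N" "v3 < N" "v4 < N" "v5 < N"
  shows "num_clause_holds A K I [w, v1, v2, v3, v4, v5] c"
  using clauses_hold[of "[v1, v2, v3, v4, v5]" c] assms by simp

lemma Next_derivable: "Suc u < N \<Longrightarrow> I Next u (Suc u)"
proof -
  assume u: "Suc u < N"
  then obtain C where C: "C \<in> set (next_conditions (term_tuple K (X 1)) (term_tuple K (X 2)))"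
      "\<forall>a \<in> set C. sat_atom A [] (digit_env A K [w, u, Suc u, 0, 0, 0]) a"
    using next_conditions_digits[of "[w, u, Suc u, 0, 0, 0]" "[]"] by auto
  have "NClause (map Neg C) [] (Some (Next, X 1, X 2)) \<in> set (definite_clauses \<sigma> K M)"
    using C(1) by (simp add: definite_clauses_def arithmetic_clauses_def)
  from clause_instance[OF this, of u "Suc u" 0 0 0] show ?thesis
    using u N_pos C(2) by simp
qed

lemma Less_derivable: "u < v \<Longrightarrow> v < N \<Longrightarrow> I Less u v"
proof (induction v)
  case 0
  then show ?case by simp
next
  case (Suc v)
  show ?case
  proof (cases "u = v")
    case True
    have "rule [(Next, X 1, X 2)] (Less, X 1, X 2) \<in> set (definite_clauses \<sigma> K M)"
      by (simp add: definite_clauses_def arithmetic_clauses_def)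
    from clause_instance[OF this, of u "Suc u" 0 0 0] show ?thesis
      using Suc.prems True N_pos Next_derivable by simp
  next
    case False
    have "rule [(Less, X 1, X 2), (Next, X 2, X 3)] (Less, X 1, X 3) \<in> set (definite_clauses \<sigma> K M)"
      by (simp add: definite_clauses_def arithmetic_clauses_def)
    from clause_instance[OF this, of u v "Suc v" 0 0] show ?thesis
      using Suc False N_pos Next_derivable by simp
  qed
qed

lemma Double_derivable: "2 * u < N \<Longrightarrow> I Double u (2 * u)"
proof (induction u)
  case 0
  have "rule [] (Double, zero, zero) \<in> set (definite_clauses \<sigma> K M)"
    by (simp add: definite_clauses_def arithmetic_clauses_def)
  from clause_instance[OF this, of 0 0 0 0 0] show ?case
    using N_pos by simp
next
  case (Suc u)
  have "rule [(Double, X 1, X 2), (Next, X 1, X 3), (Next, X 2, X 4), (Next, X 4, X 5)] (Double, X 3, X 5)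
      \<in> set (definite_clauses \<sigma> K M)"
    by (simp add: definite_clauses_def arithmetic_clauses_def)
  from clause_instance[OF this, of u "2 * u" "Suc u" "Suc (2 * u)" "Suc (Suc (2 * u))"] show ?case
    using Suc Next_derivable by simp
qed

lemma block_clause_mem:
  "j < length (blocks \<sigma>) \<Longrightarrow> c \<in> set (block_clauses \<sigma> K j) \<Longrightarrow> c \<in> set (definite_clauses \<sigma> K M)"
  by (auto simp: definite_clauses_def input_clauses_def)

lemma power_arity_le: "j < length (blocks \<sigma>) \<Longrightarrow> n ^ block_arity \<sigma> K (blocks \<sigma> ! j) \<le> N"
  using arity_le n_ge by (intro power_increasing) auto

lemma Inp_step:
  assumes "j < length (blocks \<sigma>)" "x < n ^ block_arity \<sigma> K (blocks \<sigma> ! j)"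
    "block_offset \<sigma> A K j + x < N" "I (Inp j) 0 (block_offset \<sigma> A K j)"
  shows "I (Inp j) x (block_offset \<sigma> A K j + x)"
  using assms(2,3)
proof (induction x)
  case 0
  then show ?case using assms(4) by simp
next
  case (Suc x)
  define b p where "b = blocks \<sigma> ! j" and "p = block_offset \<sigma> A K j + x"
  have le: "n ^ block_arity \<sigma> K b \<le> N" using power_arity_le assms(1) by (simp add: b_def)
  have "0 < n ^ block_arity \<sigma> K b" using n_ge by simp
  then have *: "n ^ block_arity \<sigma> K b - 1 < N" using le by linarith
  have x: "Suc x < N" using Suc.prems le by (simp add: b_def)
  have Less: "I Less x (n ^ block_arity \<sigma> K b - 1)"
    using Suc.prems by (intro Less_derivable *) (simp add: b_def)
  have mem: "rule [(Inp j, X 1, X 2), (Less, X 1, NMax (block_arity \<sigma> K b)), (Next, X 1, X 3), (Next, X 2, X 4)]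
      (Inp j, X 3, X 4) \<in> set (definite_clauses \<sigma> K M)"
    by (rule block_clause_mem[OF assms(1)]) (simp add: block_clauses_def b_def Let_def)
  have IH: "I (Inp j) x p" using Suc by (simp add: p_def)
  have p: "Suc p < N" using Suc.prems by (simp add: p_def)
  have "I (Inp j) (Suc x) (Suc p)"
    using clause_instance[OF mem, of x p "Suc x" "Suc p" 0] IH Less x p N_pos
      Next_derivable[OF x] Next_derivable[OF p] by simp
  then show ?case by (simp add: p_def)
qed

text \<open>Offsets are not computed arithmetically: the rules walk through block \<open>j\<close>
  to its last entry, and the link steps to the next cell.\<close>

lemma Inp_derivable_0:
  "j < length (blocks \<sigma>) \<Longrightarrow> block_offset \<sigma> A K j < N \<Longrightarrow> I (Inp j) 0 (block_offset \<sigma> A K j)"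
proof (induction j)
  case 0
  have "rule [] (Inp 0, zero, zero) \<in> set (definite_clauses \<sigma> K M)"
    by (simp add: definite_clauses_def input_clauses_def)
  from clause_instance[OF this, of 0 0 0 0 0] show ?case
    using N_pos by (simp add: block_offset_0)
next
  case (Suc j)
  define L where "L = n ^ block_arity \<sigma> K (blocks \<sigma> ! j)"
  have L: "0 < L" using n_ge by (simp add: L_def)
  have off: "block_offset \<sigma> A K (Suc j) = Suc (block_offset \<sigma> A K j + (L - 1))"
    using Suc.prems L by (simp add: block_offset_Suc L_def)
  have "I (Inp j) (L - 1) (block_offset \<sigma> A K j + (L - 1))"
    using Suc L off by (intro Inp_step) (simp_all add: L_def[symmetric])
  moreover have "block_link \<sigma> K j \<in> set (definite_clauses \<sigma> K M)"
    using Suc.prems by (simp add: definite_clauses_def input_clauses_def)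
  from clause_instance[OF this, of "block_offset \<sigma> A K j + (L - 1)" "block_offset \<sigma> A K (Suc j)" 0 0 0]
  have "I (Inp j) (L - 1) (block_offset \<sigma> A K j + (L - 1)) \<longrightarrow>
      I Next (block_offset \<sigma> A K j + (L - 1)) (block_offset \<sigma> A K (Suc j)) \<longrightarrow>
      I (Inp (Suc j)) 0 (block_offset \<sigma> A K (Suc j))"
    using Suc.prems off N_pos by (auto simp: block_link_def L_def[symmetric])
  moreover have "I Next (block_offset \<sigma> A K j + (L - 1)) (block_offset \<sigma> A K (Suc j))"
    using Suc.prems unfolding off by (intro Next_derivable)
  ultimately show ?case by blast
qed

lemma Tape_0_derivable:
  assumes p: "p < N"
  shows "I (Tape (tape_at M enc 0 p)) 0 p"
proof -
  obtain j x where j: "j < length (blocks \<sigma>)" "x < n ^ block_arity \<sigma> K (blocks \<sigma> ! j)"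
      "p = block_offset \<sigma> A K j + x"
    using input_word_cases[of p \<sigma> A K] p N_le_input_word by auto
  define b where "b = blocks \<sigma> ! j"
  have x: "x < N" using j power_arity_le[OF j(1)] by simp
  have Inp: "I (Inp j) x p"
    unfolding j(3) using j p by (intro Inp_step Inp_derivable_0) auto
  have tape: "tape_at M enc 0 p = block_symbol b (block_bit \<sigma> A b x)"
    using tape_at_0[OF p] nth_input_word[OF j(1,2)] j(3) by (simp add: b_def)
  have sat: "sat_atom A [] (digit_env A K [w, x, p, 0, 0, 0]) (block_atom \<sigma> K b) \<longleftrightarrow> block_bit \<sigma> A b x"
    using sat_block_atom[of "[w, x, p, 0, 0, 0]" K \<sigma> b A "[]"] j K_pos arity_le by (auto simp: b_def)
  have mem: "NClause [Neg (block_atom \<sigma> K b)] [(Inp j, X 1, X 2)] (Some (Tape (block_symbol b True), zero, X 2))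
        \<in> set (definite_clauses \<sigma> K M)"
      "NClause [Pos (block_atom \<sigma> K b)] [(Inp j, X 1, X 2)] (Some (Tape (block_symbol b False), zero, X 2))
        \<in> set (definite_clauses \<sigma> K M)"
    by (rule block_clause_mem[OF j(1)], simp add: block_clauses_def b_def Let_def)+
  show ?thesis
    using clause_instance[OF mem(1), of x p 0 0 0] clause_instance[OF mem(2), of x p 0 0 0]
      Inp sat x p N_pos tape
    by (cases "block_bit \<sigma> A b x") simp_all
qed

lemma transition_clause_mem:
  "q < nstates M \<Longrightarrow> a < nsymbols M \<Longrightarrow> c \<in> set (transition_clauses M q a) \<Longrightarrow>
    c \<in> set (definite_clauses \<sigma> K M)"
  unfolding definite_clauses_def machine_clauses_def set_append set_concat set_map set_upt by fastforce

lemma run_derivable: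
  "t < N \<Longrightarrow> I (Head (state_at M enc t)) t (head_at M enc t) \<and>
    (\<forall>p<N. I (Tape (tape_at M enc t p)) t p)"
proof (induction t)
  case 0
  have "rule [] (Head 0, zero, zero) \<in> set (definite_clauses \<sigma> K M)"
    by (simp add: definite_clauses_def input_clauses_def)
  from clause_instance[OF this, of 0 0 0 0 0] have "I (Head 0) 0 0"
    using N_pos by simp
  then show ?case using Tape_0_derivable by (simp add: run_0 init_config_def)
next
  case (Suc t)
  define q h f where "q = state_at M enc t" and "h = head_at M enc t" and "f = tape_at M enc t"
  obtain q' a' d where m: "machine_move M q (f h) = (q', a', d)" by (metis prod.exhaust)
  have run: "run M enc (Suc t) = (q', move_head d h, f(h := a'))"
    using run_Suc[of M enc t q' a' d] m by (simp add: q_def h_def f_def)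
  have t: "t < N" "Suc t < N" using Suc.prems by auto
  \<comment> \<open>The head is at most at cell \<open>t\<close>, and \<open>Suc t < N\<close>;
    hence the target of a right move is representable.\<close>
  have h: "h < N" "Suc h < N"
    using head_at_le[of M enc t] Suc.prems by (simp_all add: h_def)
  have qf: "q < nstates M" "f p < nsymbols M" for p
    using run_wf[OF wf_M, of enc t] by (simp_all add: q_def f_def)
  have IH: "I (Head q) t h" "p < N \<Longrightarrow> I (Tape (f p)) t p" for p
    using Suc by (simp_all add: q_def h_def f_def)
  have Next: "I Next t (Suc t)" by (rule Next_derivable[OF t(2)])
  have inst: "num_clause_holds A K I [w, t, v2, Suc t, v4, 0] c"
    if "c \<in> set (transition_clauses M q (f p))" "v2 < N" "v4 < N" for v2 v4 c p
    using that t N_pos by (intro clause_instance transition_clause_mem[of q "f p"] qf)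
  have "I (Head q') (Suc t) (move_head d h)"
  proof (cases d)
    case Stay
    have "rule [(Head q, X 1, X 2), (Tape (f h), X 1, X 2), (Next, X 1, X 3)] (Head q', X 3, X 2)
        \<in> set (transition_clauses M q (f h))"
      by (simp add: transition_clauses_def m Stay)
    from inst[OF this h(1) N_pos] show ?thesis using IH h Next Stay by simp
  next
    case MoveRight
    have "rule [(Head q, X 1, X 2), (Tape (f h), X 1, X 2), (Next, X 1, X 3), (Next, X 2, X 4)]
        (Head q', X 3, X 4) \<in> set (transition_clauses M q (f h))"
      by (simp add: transition_clauses_def m MoveRight)
    from inst[OF this h] show ?thesis using IH h Next MoveRight Next_derivable[OF h(2)] by simp
  next
    case MoveLeft
    show ?thesis
    proof (cases h)
      case 0
      have "rule [(Head q, X 1, zero), (Tape (f h), X 1, zero), (Next, X 1, X 3)] (Head q', X 3, zero)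
          \<in> set (transition_clauses M q (f h))"
        by (simp add: transition_clauses_def m MoveLeft)
      from inst[OF this h(1) N_pos] show ?thesis using IH h Next MoveLeft 0 by simp
    next
      case (Suc g)
      have "rule [(Head q, X 1, X 2), (Tape (f h), X 1, X 2), (Next, X 1, X 3), (Next, X 4, X 2)]
          (Head q', X 3, X 4) \<in> set (transition_clauses M q (f h))"
        by (simp add: transition_clauses_def m MoveLeft)
      from inst[OF this h(1), of g] show ?thesis
        using IH h Next MoveLeft Next_derivable[of g] Suc by simp
    qed
  qed
  moreover have "I (Tape ((f(h := a')) p)) (Suc t) p" if p: "p < N" for p
  proof -
    consider "p = h" | "h < p" | "p < h" by linarith
    then show ?thesis
    proof cases
      case 1
      have "rule [(Head q, X 1, X 2), (Tape (f h), X 1, X 2), (Next, X 1, X 3)] (Tape a', X 3, X 2)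
          \<in> set (transition_clauses M q (f h))"
        by (simp add: transition_clauses_def m)
      from inst[OF this h(1) N_pos] show ?thesis using IH h Next 1 by simp
    next
      case 2
      \<comment> \<open>The frame rule is taken from the group for the symbol \<open>f p\<close> of
        the copied cell, not for the scanned \<open>f h\<close>.\<close>
      have "rule [(Head q, X 1, X 2), (Tape (f p), X 1, X 4), (Less, X 2, X 4), (Next, X 1, X 3)]
          (Tape (f p), X 3, X 4) \<in> set (transition_clauses M q (f p))"
        by (cases "machine_move M q (f p)") (simp add: transition_clauses_def)
      from inst[OF this h(1) p] show ?thesis
        using IH(1) IH(2)[OF p] Next 2 Less_derivable[OF 2 p] by simp
    next
      case 3
      have "rule [(Head q, X 1, X 2), (Tape (f p), X 1, X 4), (Less, X 4, X 2), (Next, X 1, X 3)]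
          (Tape (f p), X 3, X 4) \<in> set (transition_clauses M q (f p))"
        by (cases "machine_move M q (f p)") (simp add: transition_clauses_def)
      from inst[OF this h(1) p] show ?thesis
        using IH(1) IH(2)[OF p] Next 3 Less_derivable[OF 3 h(1)] by simp
    qed
  qed
  ultimately show ?case by (simp add: run del: fun_upd_apply)
qed

lemma output_tape_derivable:
  "i < length y \<Longrightarrow> I (Tape (bit_symbol (y ! i))) (N - 1) i"
  "I (Tape 0) (N - 1) (length y)"
  using run_derivable[of "N - 1"] N_pos output_bits output_end length_y_less
  by (metis diff_less less_trans zero_less_one)+

lemma Val_derivable: "i \<le> length y \<Longrightarrow> I Val i (bin_val (take i y))"
proof (induction i)
  case 0
  have "rule [] (Val, zero, zero) \<in> set (definite_clauses \<sigma> K M)"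
    by (simp add: definite_clauses_def output_clauses_def)
  from clause_instance[OF this, of 0 0 0 0 0] show ?case
    using N_pos by (simp add: bin_val_def)
next
  case (Suc i)
  define v where "v = bin_val (take i y)"
  have eq: "bin_val (take (Suc i) y) = 2 * v + of_bool (y ! i)"
    using Suc.prems by (simp add: v_def bin_val_take_Suc)
  have less: "2 * v + of_bool (y ! i) < N"
    using bin_val_take_le[of "Suc i" y] bin_val_y_less by (simp add: eq)
  have i: "Suc i < N" using Suc.prems length_y_less by simp
  have IH: "I Val i v" using Suc by (simp add: v_def)
  have facts: "I Next i (Suc i)" "I Double v (2 * v)"
      "I (Tape (bit_symbol (y ! i))) (N - 1) i"
    using Next_derivable[OF i] Double_derivable[of v] less output_tape_derivable(1)[of i] Suc.prems
    by auto
  show ?case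
  proof (cases "y ! i")
    case False
    have "rule [(Val, X 1, X 2), (Tape 1, NMax K, X 1), (Next, X 1, X 3), (Double, X 2, X 4)] (Val, X 3, X 4)
        \<in> set (definite_clauses \<sigma> K M)"
      by (simp add: definite_clauses_def output_clauses_def)
    from clause_instance[OF this, of i v "Suc i" "2 * v" 0] show ?thesis
      using False IH facts i less N_pos by (simp add: eq bit_symbol_def)
  next
    case True
    have "rule [(Val, X 1, X 2), (Tape 2, NMax K, X 1), (Next, X 1, X 3), (Double, X 2, X 4), (Next, X 4, X 5)]
        (Val, X 3, X 5) \<in> set (definite_clauses \<sigma> K M)"
      by (simp add: definite_clauses_def output_clauses_def)
    from clause_instance[OF this, of i v "Suc i" "2 * v" "Suc (2 * v)"] show ?thesis
      using True IH facts i less Next_derivable[of "2 * v"] by (simp add: eq bit_symbol_def)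
  qed
qed

lemma Bad_derivable: "bin_val y \<le> v \<Longrightarrow> v < N \<Longrightarrow> I Bad v 0"
proof (induction v rule: dec_induct)
  case base
  have "rule [(Val, X 1, X 2), (Tape 0, NMax K, X 1)] (Bad, X 2, zero) \<in> set (definite_clauses \<sigma> K M)"
    by (simp add: definite_clauses_def output_clauses_def)
  from clause_instance[OF this, of "length y" "bin_val y" 0 0 0] show ?case
    using Val_derivable[of "length y"] output_tape_derivable(2) length_y_less bin_val_y_less N_pos by simp
next
  case (step v)
  have "rule [(Bad, X 1, zero), (Next, X 1, X 2)] (Bad, X 2, zero) \<in> set (definite_clauses \<sigma> K M)"
    by (simp add: definite_clauses_def output_clauses_def)
  from clause_instance[OF this, of v "Suc v" 0 0 0] show ?case
    using step Next_derivable[of v] N_pos by simp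
qed

end


section \<open>The number of counted tuples\<close>

lemma goal_clause_wf: "wf_num_clause \<sigma> (num_preds \<sigma> M) 6 K goal_clause"
  by (simp add: goal_clause_def num_preds_def)

context simulation
begin

lemma n_pos: "0 < n"
  using n_ge by simp

definition count :: "nat list set list \<Rightarrow> nat" where
  "count S = card {w \<in> tuples n K. \<forall>x \<in> tuples n (5 * K).
     sat_cnf A S (w @ x) (map (clause_of K) (goal_clause # definite_clauses \<sigma> K M))}"

lemma clauses_wf: "c \<in> set (goal_clause # definite_clauses \<sigma> K M) \<Longrightarrow>
    wf_num_clause \<sigma> (num_preds \<sigma> M) 6 K c"
  using definite_clauses_wf[OF K_pos arity_le wf_M] goal_clause_wf by auto

lemma sat_clauses:
  "(\<forall>x \<in> tuples n (5 * K).
      sat_cnf A S (digits n K w @ x) (map (clause_of K) (goal_clause # definite_clauses \<sigma> K M))) \<longleftrightarrow>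
    (\<forall>vs. length vs = 5 \<longrightarrow> set vs \<subseteq> {..<N} \<longrightarrow>
      (\<forall>c \<in> set (goal_clause # definite_clauses \<sigma> K M).
        num_clause_holds A K (interp_of n K S) (w # vs) c))"
  by (rule sat_num_clauses[OF n_ge, of _ \<sigma> "num_preds \<sigma> M"]) (use clauses_wf in simp)

lemma count_le:
  "count S \<le> bin_val y"
proof -
  let ?W = "{w \<in> tuples n K. \<forall>x \<in> tuples n (5 * K).
     sat_cnf A S (w @ x) (map (clause_of K) (goal_clause # definite_clauses \<sigma> K M))}"
  have "?W \<subseteq> digits n K ` {..<bin_val y}"
  proof
    fix t assume t: "t \<in> ?W"
    then obtain w where w: "t = digits n K w" "w < N"
      using tuples_eq_digits[of n K] n_ge by auto
    have holds: "num_clause_holds A K (interp_of n K S) (w # vs) c"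
      if "length vs = 5" "set vs \<subseteq> {..<N}" "c \<in> set (goal_clause # definite_clauses \<sigma> K M)" for vs c
      using t sat_clauses[of S w] that unfolding w(1) by blast
    interpret simulation_model \<sigma> A M K y "interp_of n K S" w
      by unfold_locales (use holds in simp)
    \<comment> \<open>The goal clause mentions only variable 0, so any five numbers complete the
      instance.\<close>
    have "\<not> interp_of n K S Bad w 0"
      using holds[of "replicate 5 0" goal_clause] N_pos by (simp add: goal_clause_def)
    then have "w < bin_val y" using Bad_derivable[OF _ w(2)] by force
    then show "t \<in> digits n K ` {..<bin_val y}" using w(1) by simp
  qed
  then have "card ?W \<le> card (digits n K ` {..<bin_val y})" by (intro card_mono) auto
  also have "\<dots> \<le> bin_val y" using card_image_le[of "{..<bin_val y}" "digits n K"] by simp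
  finally show ?thesis unfolding count_def .
qed

lemma count_attained:
  "count (relations_of n K (num_preds \<sigma> M) intended) = bin_val y" (is "count ?S = _")
proof -
  have "(\<forall>x \<in> tuples n (5 * K).
      sat_cnf A ?S (digits n K w @ x) (map (clause_of K) (goal_clause # definite_clauses \<sigma> K M))) \<longleftrightarrow>
    w < bin_val y" if w: "w < N" for w
  proof -
    have eq: "num_clause_holds A K (interp_of n K ?S) (w # vs) c \<longleftrightarrow> num_clause_holds A K intended (w # vs) c"
      if "length vs = 5" "set vs \<subseteq> {..<N}" "c \<in> set (goal_clause # definite_clauses \<sigma> K M)" for vs c
      using that w clauses_wf by (intro num_clause_holds_relations_of[OF n_ge, of \<sigma>]) auto
    have definite: "num_clause_holds A K intended (w # vs) c"
      if "length vs = 5" "set vs \<subseteq> {..<N}" "c \<in> set (definite_clauses \<sigma> K M)" for vs c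
      using that w by (intro definite_clauses_intended) auto
    have goal: "num_clause_holds A K intended (w # vs) goal_clause \<longleftrightarrow> w < bin_val y" for vs
      by (auto simp: goal_clause_def)
    \<comment> \<open>A sample value of \<open>x\<close>: without one, the universal condition would
      hold vacuously for every \<open>w\<close>.\<close>
    have vs: "length (replicate 5 (0 :: nat)) = 5" "set (replicate 5 (0 :: nat)) \<subseteq> {..<N}"
      using N_pos by auto
    have "(\<forall>c \<in> set (goal_clause # definite_clauses \<sigma> K M).
        num_clause_holds A K (interp_of n K ?S) (w # vs) c) \<longleftrightarrow> w < bin_val y"
      if "length vs = 5" "set vs \<subseteq> {..<N}" for vs
      using eq[OF that] definite[OF that] goal[of vs] by simp
    then show ?thesis
      unfolding sat_clauses using vs by blast
  qed
  then have "{w \<in> {..<N}. \<forall>x \<in> tuples n (5 * K).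
      sat_cnf A ?S (digits n K w @ x) (map (clause_of K) (goal_clause # definite_clauses \<sigma> K M))} =
    {w \<in> {..<N}. w < bin_val y}"
    by (intro Collect_cong conj_cong refl) (simp only: lessThan_iff)
  also have "\<dots> = {..<bin_val y}"
    using bin_val_y_less by auto
  finally have *: "{w \<in> {..<N}. \<forall>x \<in> tuples n (5 * K).
      sat_cnf A ?S (digits n K w @ x) (map (clause_of K) (goal_clause # definite_clauses \<sigma> K M))} =
    {..<bin_val y}" .
  have image: "{w \<in> digits n K ` {..<N}. P w} = digits n K ` {w \<in> {..<N}. P (digits n K w)}" for P
    by blast
  have "{w \<in> tuples n K. \<forall>x \<in> tuples n (5 * K).
      sat_cnf A ?S (w @ x) (map (clause_of K) (goal_clause # definite_clauses \<sigma> K M))} =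
    digits n K ` {..<bin_val y}"
    unfolding tuples_eq_digits[OF n_pos, of K] image * ..
  moreover have "inj_on (digits n K) {..<bin_val y}"
    using inj_on_digits by (rule inj_on_subset) (use bin_val_y_less in auto)
  ultimately show ?thesis by (simp add: count_def card_image)
qed

lemma Max_count:
  "Max {count S | S. S \<in> interpretations n (replicate (num_preds \<sigma> M) (2 * K))} = bin_val y"
proof (rule Max_eqI)
  show "finite {count S | S. S \<in> interpretations n (replicate (num_preds \<sigma> M) (2 * K))}"
    by (rule finite_subset[of _ "{..bin_val y}"]) (auto simp: count_le)
  show "bin_val y \<in> {count S | S. S \<in> interpretations n (replicate (num_preds \<sigma> M) (2 * K))}"
    using count_attained relations_of_interpretations[of n K "num_preds \<sigma> M" intended] n_ge
    by (intro CollectI exI[of _ "relations_of n K (num_preds \<sigma> M) intended"]) simp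
qed (auto simp: count_le)

end

section \<open>The choice of \<open>K\<close> and the representation of the optimum\<close>

lemma exists_digit_count:
  fixes p q :: "nat poly"
  shows "\<exists>K>0. (\<forall>b \<in> set (blocks \<sigma>). block_arity \<sigma> K b \<le> K) \<and>
    (\<forall>A \<in> structures \<sigma>. length (encode \<sigma> A) < usize A ^ K \<and>
      poly p (length (encode \<sigma> A)) < usize A ^ K \<and> poly q (length (encode \<sigma> A)) < usize A ^ K)"
proof -
  obtain d where d: "\<forall>A \<in> structures \<sigma>. length (encode \<sigma> A) < usize A ^ d"
    using length_encode_bound by blast
  obtain d1 d2 where d1: "\<forall>n\<ge>2. poly p (n ^ d) < n ^ d1" and d2: "\<forall>n\<ge>2. poly q (n ^ d) < n ^ d2"
    using poly_nat_power_bound by meson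
  \<comment> \<open>The exponent \<open>d\<close> bounds the encoding length, \<open>d1\<close> and
    \<open>d2\<close> the two polynomials at that length. The sum bounds each relation arity, and
    \<open>Suc\<close> gives positivity and covers the unary blocks. Nothing here depends on the
    structure.\<close>
  define K where "K = Suc (d + d1 + d2 + sum_list (rel_arities \<sigma>))"
  have "block_arity \<sigma> K b \<le> K" if "b \<in> set (blocks \<sigma>)" for b
    using that elem_le_sum_list[of _ "rel_arities \<sigma>"] by (fastforce simp: blocks_def K_def)
  moreover have "length (encode \<sigma> A) < usize A ^ K \<and>
      poly p (length (encode \<sigma> A)) < usize A ^ K \<and> poly q (length (encode \<sigma> A)) < usize A ^ K"
    if A: "A \<in> structures \<sigma>" for A
  proof -
    have n: "2 \<le> usize A" using A by (simp add: structures_def)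
    have len: "length (encode \<sigma> A) < usize A ^ d" using d A by blast
    have "usize A ^ d \<le> usize A ^ K" "usize A ^ d1 \<le> usize A ^ K" "usize A ^ d2 \<le> usize A ^ K"
      using n by (auto simp: K_def intro!: power_increasing simp del: power_Suc)
    moreover have "poly r (length (encode \<sigma> A)) \<le> poly r (usize A ^ d)" for r :: "nat poly"
      using len by (intro poly_nat_mono) simp
    ultimately show ?thesis
      using len d1 d2 n by (meson le_less_trans less_le_trans)
  qed
  ultimately show ?thesis by (intro exI[of _ K]) (simp add: K_def)
qed

theorem theorem3:
  fixes \<sigma> :: vocabulary and Q :: max_problem
  assumes "Q \<in> class_Q' \<sigma>"
  shows "\<exists>(k :: nat) (m :: nat) (\<tau> :: nat list) (\<eta> :: cnf).
    wf_cnf \<sigma> \<tau> (k + m) \<eta> \<and> horn_cnf \<eta> \<and>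
    (\<forall>A \<in> instances Q.
       opt Q A =
         Max {card {w \<in> tuples (usize A) k. \<forall>x \<in> tuples (usize A) m. sat_cnf A S (w @ x) \<eta>} | S.
                S \<in> interpretations (usize A) \<tau>})"
proof -
  have inst: "instances Q \<subseteq> structures \<sigma>"
    using assms by (simp add: class_Q'_def class_P'_def maximisation_problem_def)
  obtain M p where M: "wf_machine M" and out: "\<And>A. A \<in> instances Q \<Longrightarrow>
      outputs_within M (encode \<sigma> A) (poly p (length (encode \<sigma> A))) (binary (opt Q A))"
  proof -
    have "polytime_computable (instances Q) (encode \<sigma>) (\<lambda>A. binary (opt Q A))"
      using assms by (simp add: class_Q'_def class_P'_def)
    then show ?thesis using that unfolding polytime_computable_def by blast
  qed
  obtain q :: "nat poly" where q: "\<And>A. A \<in> instances Q \<Longrightarrow> opt Q A \<le> poly q (length (encode \<sigma> A))"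
  proof -
    have "polynomially_bound \<sigma> Q"
      using assms by (simp add: class_Q'_def)
    then show ?thesis using that unfolding polynomially_bound_def by blast
  qed
  obtain K where K: "0 < K" "\<forall>b \<in> set (blocks \<sigma>). block_arity \<sigma> K b \<le> K"
    and less: "\<forall>A \<in> structures \<sigma>. length (encode \<sigma> A) < usize A ^ K \<and>
      poly p (length (encode \<sigma> A)) < usize A ^ K \<and> poly q (length (encode \<sigma> A)) < usize A ^ K"
    using exists_digit_count[of \<sigma> p q] by (elim exE conjE) (rule that)
  define cs where "cs = goal_clause # definite_clauses \<sigma> K M"
  define \<tau> where "\<tau> = replicate (num_preds \<sigma> M) (2 * K)"
  have cs: "wf_num_clause \<sigma> (num_preds \<sigma> M) 6 K c" if "c \<in> set cs" for c
    using that definite_clauses_wf[OF K M] goal_clause_wf by (auto simp: cs_def)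
  have wf: "wf_cnf \<sigma> \<tau> (K + 5 * K) (map (clause_of K) cs)"
    unfolding wf_cnf_def \<tau>_def list.pred_map list_all_iff[of _ cs] comp_def
    using wf_clause_of(1)[OF cs] by simp
  have horn: "horn_cnf (map (clause_of K) cs)"
    unfolding horn_cnf_def list.pred_map list_all_iff[of _ cs] comp_def
    using wf_clause_of(2)[OF cs] by blast
  have "opt Q A = Max {card {w \<in> tuples (usize A) K. \<forall>x \<in> tuples (usize A) (5 * K).
      sat_cnf A S (w @ x) (map (clause_of K) cs)} | S. S \<in> interpretations (usize A) \<tau>}"
    if A: "A \<in> instances Q" for A
  proof -
    have str: "A \<in> structures \<sigma>" using inst A by blast
    have opt: "opt Q A < usize A ^ K"
      using le_less_trans[OF q[OF A]] less[rule_format, OF str] by blast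
    \<comment> \<open>Strictness of the bound on the running time is what allows reading the tape at
      \<open>usize A ^ K - 1\<close>, the last representable time.\<close>
    have T: "poly p (length (encode \<sigma> A)) \<le> usize A ^ K - 1"
      using less[rule_format, OF str] by linarith
    have len: "length (binary (opt Q A)) < usize A ^ K"
      using length_binary_le opt by (rule le_less_trans)
    have val: "bin_val (binary (opt Q A)) < usize A ^ K"
      using opt by (simp only: bin_val_binary)
    have "length (encode \<sigma> A) < usize A ^ K"
      using less[rule_format, OF str] by blast
    then interpret simulation \<sigma> A M K "binary (opt Q A)"
      by (rule simulation.intro[OF str M K _ outputs_within_run[OF out[OF A] T] len val])
    show ?thesis
      using Max_count[symmetric] unfolding count_def cs_def \<tau>_def bin_val_binary .
  qed
  then show ?thesis
    using wf horn by (intro exI conjI ballI)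
qed

end
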